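(* For each countably infinite group $G$ there is a non-zero positive function $f \in \ell^\infty(G)$ such that $\ell_c^\infty(G,f)$ admits no non-zero invariant integral. In particular, if an invariant integral on $G$ normalized for $f$ exists, as is the case whenever $G$ has the fixed-point property for cones, then it is singular.
   Context: $G$ acts on the $C^*$-algebra $\ell^\infty(G)$ of bounded complex functions by left-translation, $(t.f)(s) = f(t^{-1}s)$. For positive $f \in \ell^\infty(G)$, $\ell^\infty(G,f)$ is the set of $g \in \ell^\infty(G)$ with $|g| \le \sum_{j=1}^n t_j.f$ for some $n \ge 1$ and $t_1,\dots,t_n \in G$; it is a $G$-invariant ideal in $\ell^\infty(G)$. $\ell_c^\infty(G,f)$ denotes the Pedersen ideal (the smallest dense algebraic two-sided ideal) of the $C^*$-algebra $\overline{\ell^\infty(G,f)}$ (uniform closure); one has $\ell_c^\infty(G,f) \subseteq \ell^\infty(G,f)$. An invariant integral on $\ell_c^\infty(G,f)$ (resp. $\ell^\infty(G,f)$) is a $G$-invariant positive linear functional on it. An invariant integral on $G$ normalized for $f$ is a $G$-invariant positive linear functional $\mu$ on $\ell^\infty(G,f)$ with $\mu(f)=1$; it is singular if its restriction to $\ell_c^\infty(G,f)$ is zero. Fixed-point property for cones (Monod): let $V$ be a real Hausdorff locally convex topological vector space on which $G$ acts by continuous linear maps, leaving invariant a convex cone $C \subseteq V$. The cone $C$ is proper if $C \cap (-C) = \{0\}$, and weakly complete if every net in $C$ that is Cauchy for the weak topology converges weakly to an element of $C$. The dual $V^*$ is preordered by $\varphi \le \psi$ iff $\varphi(c) \le \psi(c)$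 for all $c \in C$. The action is of cobounded type if there is a positive $\varphi \in V^*$ such that every $\psi \in V^*$ satisfies $\psi \le \sum_{j=1}^n t_j.\varphi$ for some $n \ge 1$ and $t_1,\dots,t_n \in G$; it is locally bounded if some non-zero $c \in C$ has bounded $G$-orbit (a set $M$ is bounded if for each open neighborhood $U$ of $0$ there is $r>0$ with $M \subseteq rU$). $G$ has the fixed-point property for cones if every such action on a proper weakly complete cone that is of cobounded type and locally bounded has a non-zero fixed point in $C$. *)

theory Defs
  imports
    "HOL-Analysis.Analysis"
    "HOL-Library.Complex_Order"
    "HOL-Algebra.Group_Action"
    "HOL-Algebra.Module"
    "HOL-Algebra.Algebraic_Closure_Type"
begin

section \<open>Invariant integrals on a group\<close>

text \<open>
  A function on a group \<open>G\<close> is represented by a function on the ambient type that vanishes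
  outside \<open>carrier G\<close>, so that equality of functions on \<open>G\<close> is equality in HOL and the pointwise
  operations need no restriction. Inequalities between complex numbers refer to the order of
  \<^theory>\<open>HOL-Library.Complex_Order\<close>; in particular \<open>0 \<le> z\<close> says that \<open>z\<close> is real and
  non-negative.
\<close>

definition linf :: "('g, 'b) monoid_scheme \<Rightarrow> ('g \<Rightarrow> complex) set" where
  "linf G = {f. (\<forall>s. s \<notin> carrier G \<longrightarrow> f s = 0) \<and> bounded (f ` carrier G)}"

definition translate :: "('g, 'b) monoid_scheme \<Rightarrow> 'g \<Rightarrow> ('g \<Rightarrow> complex) \<Rightarrow> 'g \<Rightarrow> complex" where
  "translate G t f = (\<lambda>s. if s \<in> carrier G then f (inv\<^bsub>G\<^esub> t \<otimes>\<^bsub>G\<^esub> s) else 0)"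

definition linf_dom :: "('g, 'b) monoid_scheme \<Rightarrow> ('g \<Rightarrow> complex) \<Rightarrow> ('g \<Rightarrow> complex) set" where
  "linf_dom G f = {g \<in> linf G. \<exists>n\<ge>1. \<exists>t :: nat \<Rightarrow> 'g. (\<forall>j\<in>{1..n}. t j \<in> carrier G) \<and>
     (\<forall>s\<in>carrier G. complex_of_real (cmod (g s)) \<le> (\<Sum>j=1..n. translate G (t j) f s))}"

definition unif_closure ::
    "('g, 'b) monoid_scheme \<Rightarrow> ('g \<Rightarrow> complex) set \<Rightarrow> ('g \<Rightarrow> complex) set" where
  "unif_closure G S =
     {g \<in> linf G. \<forall>\<epsilon>>0. \<exists>h\<in>S. \<forall>s\<in>carrier G. cmod (g s - h s) \<le> \<epsilon>}"

text \<open>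
  Dense algebraic ideals of a C*-subalgebra \<open>A\<close> of \<open>linf G\<close>. As \<open>A\<close> is commutative, one-sided
  multiplication suffices for two-sided ideals.
\<close>

definition dense_ideal ::
    "('g, 'b) monoid_scheme \<Rightarrow> ('g \<Rightarrow> complex) set \<Rightarrow> ('g \<Rightarrow> complex) set \<Rightarrow> bool" where
  "dense_ideal G A J \<longleftrightarrow>
     J \<subseteq> A \<and> (\<lambda>_. 0) \<in> J \<and>
     (\<forall>g\<in>J. \<forall>h\<in>J. (\<lambda>s. g s + h s) \<in> J) \<and>
     (\<forall>c :: complex. \<forall>g\<in>J. (\<lambda>s. c * g s) \<in> J) \<and>
     (\<forall>a\<in>A. \<forall>g\<in>J. (\<lambda>s. a s * g s) \<in> J) \<and>
     A \<subseteq> unif_closure G J"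

text \<open>
  The smallest dense ideal with respect to inclusion; every C*-algebra has one, so the
  description by \<open>LEAST\<close> is proper whenever \<open>A\<close> is a C*-subalgebra of \<open>linf G\<close>.
\<close>

definition pedersen_ideal ::
    "('g, 'b) monoid_scheme \<Rightarrow> ('g \<Rightarrow> complex) set \<Rightarrow> ('g \<Rightarrow> complex) set" where
  "pedersen_ideal G A = (LEAST J. dense_ideal G A J)"

definition linf_c :: "('g, 'b) monoid_scheme \<Rightarrow> ('g \<Rightarrow> complex) \<Rightarrow> ('g \<Rightarrow> complex) set" where
  "linf_c G f = pedersen_ideal G (unif_closure G (linf_dom G f))"

text \<open>
  A functional on a subspace \<open>S\<close> of \<open>linf G\<close> is a HOL function of which only the values on \<open>S\<close>
  matter; accordingly it is zero if it vanishes on \<open>S\<close>.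
\<close>

definition invariant_integral ::
    "('g, 'b) monoid_scheme \<Rightarrow> ('g \<Rightarrow> complex) set \<Rightarrow> (('g \<Rightarrow> complex) \<Rightarrow> complex) \<Rightarrow> bool" where
  "invariant_integral G S \<mu> \<longleftrightarrow>
     (\<forall>g\<in>S. \<forall>h\<in>S. \<mu> (\<lambda>s. g s + h s) = \<mu> g + \<mu> h) \<and>
     (\<forall>c :: complex. \<forall>g\<in>S. \<mu> (\<lambda>s. c * g s) = c * \<mu> g) \<and>
     (\<forall>g\<in>S. (\<forall>s. 0 \<le> g s) \<longrightarrow> 0 \<le> \<mu> g) \<and>
     (\<forall>t\<in>carrier G. \<forall>g\<in>S. \<mu> (translate G t g) = \<mu> g)"

definition normalized_integral ::
    "('g, 'b) monoid_scheme \<Rightarrow> ('g \<Rightarrow> complex) \<Rightarrow> (('g \<Rightarrow> complex) \<Rightarrow> complex) \<Rightarrow> bool" where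
  "normalized_integral G f \<mu> \<longleftrightarrow> invariant_integral G (linf_dom G f) \<mu> \<and> \<mu> f = 1"

definition singular_integral ::
    "('g, 'b) monoid_scheme \<Rightarrow> ('g \<Rightarrow> complex) \<Rightarrow> (('g \<Rightarrow> complex) \<Rightarrow> complex) \<Rightarrow> bool" where
  "singular_integral G f \<mu> \<longleftrightarrow> (\<forall>g\<in>linf_c G f. \<mu> g = 0)"


section \<open>The fixed-point property for cones\<close>

text \<open>
  Real vector spaces are modules with explicit carrier over the field of real numbers, so that
  one can quantify over all of them within a given type; the topology is an abstract topology on
  the carrier.
\<close>

abbreviation real_field_ring :: "real ring" where
  "real_field_ring \<equiv> ring_of_type_algebra"

definition convex_in :: "(real, 'v) module \<Rightarrow> 'v set \<Rightarrow> bool" where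
  "convex_in V W \<longleftrightarrow>
     (\<forall>x\<in>W. \<forall>y\<in>W. \<forall>a. 0 \<le> a \<and> a \<le> 1 \<longrightarrow> (a \<odot>\<^bsub>V\<^esub> x) \<oplus>\<^bsub>V\<^esub> ((1 - a) \<odot>\<^bsub>V\<^esub> y) \<in> W)"

definition hausdorff_lctvs :: "(real, 'v) module \<Rightarrow> 'v topology \<Rightarrow> bool" where
  "hausdorff_lctvs V T \<longleftrightarrow>
     module real_field_ring V \<and> topspace T = carrier V \<and> Hausdorff_space T \<and>
     continuous_map (prod_topology T T) T (\<lambda>(x, y). x \<oplus>\<^bsub>V\<^esub> y) \<and>
     continuous_map (prod_topology euclideanreal T) T (\<lambda>(a, x). a \<odot>\<^bsub>V\<^esub> x) \<and>
     (\<forall>U. openin T U \<and> \<zero>\<^bsub>V\<^esub> \<in> U \<longrightarrow>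
        (\<exists>W. openin T W \<and> \<zero>\<^bsub>V\<^esub> \<in> W \<and> W \<subseteq> U \<and> convex_in V W))"

definition dual_space :: "(real, 'v) module \<Rightarrow> 'v topology \<Rightarrow> ('v \<Rightarrow> real) set" where
  "dual_space V T = {\<phi>. continuous_map T euclideanreal \<phi> \<and>
     (\<forall>x\<in>carrier V. \<forall>y\<in>carrier V. \<phi> (x \<oplus>\<^bsub>V\<^esub> y) = \<phi> x + \<phi> y) \<and>
     (\<forall>a. \<forall>x\<in>carrier V. \<phi> (a \<odot>\<^bsub>V\<^esub> x) = a * \<phi> x)}"

definition weak_topology :: "(real, 'v) module \<Rightarrow> 'v topology \<Rightarrow> 'v topology" where
  "weak_topology V T = topology_generated_by
     {{x \<in> carrier V. \<phi> x \<in> U} |\<phi> U. \<phi> \<in> dual_space V T \<and> open U}"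

definition bounded_in :: "(real, 'v) module \<Rightarrow> 'v topology \<Rightarrow> 'v set \<Rightarrow> bool" where
  "bounded_in V T M \<longleftrightarrow> (\<forall>U. openin T U \<and> \<zero>\<^bsub>V\<^esub> \<in> U \<longrightarrow>
     (\<exists>r>0. M \<subseteq> (\<lambda>u. r \<odot>\<^bsub>V\<^esub> u) ` U))"

definition cone_in :: "(real, 'v) module \<Rightarrow> 'v set \<Rightarrow> bool" where
  "cone_in V C \<longleftrightarrow> C \<subseteq> carrier V \<and> C \<noteq> {} \<and>
     (\<forall>x\<in>C. \<forall>y\<in>C. x \<oplus>\<^bsub>V\<^esub> y \<in> C) \<and> (\<forall>a\<ge>0. \<forall>x\<in>C. a \<odot>\<^bsub>V\<^esub> x \<in> C)"

definition proper_cone :: "(real, 'v) module \<Rightarrow> 'v set \<Rightarrow> bool" where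
  "proper_cone V C \<longleftrightarrow> C \<inter> (\<lambda>x. \<ominus>\<^bsub>V\<^esub> x) ` C = {\<zero>\<^bsub>V\<^esub>}"

text \<open>
  Nets in \<open>C\<close> are rendered by proper filters containing \<open>C\<close>: a net corresponds to the filter of
  sets in which it eventually lies, and every proper filter arises in this way.
\<close>

definition weakly_complete :: "(real, 'v) module \<Rightarrow> 'v topology \<Rightarrow> 'v set \<Rightarrow> bool" where
  "weakly_complete V T C \<longleftrightarrow>
     (\<forall>F :: 'v filter. F \<noteq> bot \<and> (\<forall>\<^sub>F x in F. x \<in> C) \<and>
        (\<forall>U. openin (weak_topology V T) U \<and> \<zero>\<^bsub>V\<^esub> \<in> U \<longrightarrow>
           (\<forall>\<^sub>F (x, y) in F \<times>\<^sub>F F. x \<ominus>\<^bsub>V\<^esub> y \<in> U))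
      \<longrightarrow> (\<exists>c\<in>C. limitin (weak_topology V T) (\<lambda>x. x) c F))"

definition continuous_linear_action ::
    "('g, 'b) monoid_scheme \<Rightarrow> (real, 'v) module \<Rightarrow> 'v topology \<Rightarrow> ('g \<Rightarrow> 'v \<Rightarrow> 'v) \<Rightarrow> bool" where
  "continuous_linear_action G V T \<alpha> \<longleftrightarrow>
     group_action G (carrier V) \<alpha> \<and>
     (\<forall>t\<in>carrier G. continuous_map T T (\<alpha> t) \<and>
        (\<forall>x\<in>carrier V. \<forall>y\<in>carrier V. \<alpha> t (x \<oplus>\<^bsub>V\<^esub> y) = \<alpha> t x \<oplus>\<^bsub>V\<^esub> \<alpha> t y) \<and>
        (\<forall>a. \<forall>x\<in>carrier V. \<alpha> t (a \<odot>\<^bsub>V\<^esub> x) = a \<odot>\<^bsub>V\<^esub> \<alpha> t x))"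

text \<open>The group acts on the dual by \<open>(t.\<phi>)(x) = \<phi>(t\<inverse>.x)\<close>.\<close>

definition cobounded_type ::
    "('g, 'b) monoid_scheme \<Rightarrow> (real, 'v) module \<Rightarrow> 'v topology \<Rightarrow> 'v set \<Rightarrow> ('g \<Rightarrow> 'v \<Rightarrow> 'v) \<Rightarrow> bool" where
  "cobounded_type G V T C \<alpha> \<longleftrightarrow>
     (\<exists>\<phi>\<in>dual_space V T. (\<forall>c\<in>C. 0 \<le> \<phi> c) \<and>
        (\<forall>\<psi>\<in>dual_space V T. \<exists>n\<ge>1. \<exists>t :: nat \<Rightarrow> 'g. (\<forall>j\<in>{1..n}. t j \<in> carrier G) \<and>
           (\<forall>c\<in>C. \<psi> c \<le> (\<Sum>j=1..n. \<phi> (\<alpha> (inv\<^bsub>G\<^esub> (t j)) c)))))"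

definition locally_bounded_action ::
    "('g, 'b) monoid_scheme \<Rightarrow> (real, 'v) module \<Rightarrow> 'v topology \<Rightarrow> 'v set \<Rightarrow> ('g \<Rightarrow> 'v \<Rightarrow> 'v) \<Rightarrow> bool" where
  "locally_bounded_action G V T C \<alpha> \<longleftrightarrow>
     (\<exists>c\<in>C. c \<noteq> \<zero>\<^bsub>V\<^esub> \<and> bounded_in V T (orbit G \<alpha> c))"

text \<open>
  HOL cannot quantify over all types inside a formula. The property is therefore relative to a
  type \<open>'v\<close>: it concerns the actions on all locally convex spaces whose underlying set is a set
  of elements of \<open>'v\<close>, hence, up to isomorphism, on all those of at most the cardinality of \<open>'v\<close>.
  The type \<open>('g \<Rightarrow> complex) \<Rightarrow> complex\<close> accommodates the algebraic duals of all
  \<open>linf_dom G f\<close>, and the property for it already implies the property for every type.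
\<close>

definition fixed_point_property_cones :: "('g, 'b) monoid_scheme \<Rightarrow> 'v itself \<Rightarrow> bool" where
  "fixed_point_property_cones G (_ :: 'v itself) \<longleftrightarrow>
     (\<forall>(V :: (real, 'v) module) T C \<alpha>.
        hausdorff_lctvs V T \<and> continuous_linear_action G V T \<alpha> \<and>
        cone_in V C \<and> (\<forall>t\<in>carrier G. \<forall>c\<in>C. \<alpha> t c \<in> C) \<and>
        proper_cone V C \<and> weakly_complete V T C \<and>
        cobounded_type G V T C \<alpha> \<and> locally_bounded_action G V T C \<alpha>
      \<longrightarrow> (\<exists>c\<in>C. c \<noteq> \<zero>\<^bsub>V\<^esub> \<and> (\<forall>t\<in>carrier G. \<alpha> t c = c)))"

end

theory Submission
  imports Defs
begin

text \<open>
  The Pedersen ideal of the closure of \<open>linf_dom G f\<close> consists of the bounded functions supported in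
  finitely many translates of a superlevel set \<open>{f \<ge> \<epsilon>}\<close>, so an invariant integral on it is governed by
  a finitely additive invariant measure on these sets. Choose elements \<open>x\<^sub>0, x\<^sub>1, \<dots>\<close> of \<open>G\<close> such that the
  products \<open>x\<^bsub>i\<^sub>1\<^esub> \<dots> x\<^bsub>i\<^sub>n\<^esub>\<close> with \<open>i\<^sub>1 < \<dots> < i\<^sub>n\<close> are pairwise distinct, let \<open>A\<^sub>n\<close> be the set of those of length
  \<open>n\<close>, and let \<open>f\<close> be \<open>1 / (n + 1)\<close> on \<open>A\<^sub>n\<close> and \<open>0\<close> elsewhere. Every \<open>A\<^sub>n\<close> has finite measure, but up to sets
  that are null by induction \<open>A\<^sub>n\<^sub>+\<^sub>1\<close> contains infinitely many disjoint translates of \<open>A\<^sub>n\<close>. Hence all the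
  \<open>A\<^sub>n\<close> are null, and the integral vanishes.

  For the last claim the fixed-point property is applied to the cone of positive functionals on
  \<open>linf_dom G f\<close>. This cone is placed in the space of all complex functions on the function space, with
  the product topology, rather than in the algebraic dual: a continuous functional depends on finitely
  many coordinates, so on the cone it is the real part of the evaluation at one element of
  \<open>linf_dom G f\<close>.
\<close>

section \<open>Positive functionals on solid spaces of functions\<close>

definition solid_subspace :: "('g, 'b) monoid_scheme \<Rightarrow> ('g \<Rightarrow> complex) set \<Rightarrow> bool" where
  "solid_subspace G S \<longleftrightarrow> S \<subseteq> linf G \<and> (\<lambda>_. 0) \<in> S \<and>
     (\<forall>g\<in>S. \<forall>h\<in>S. (\<lambda>s. g s + h s) \<in> S) \<and> (\<forall>c. \<forall>g\<in>S. (\<lambda>s. c * g s) \<in> S) \<and>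
     (\<forall>u\<in>S. \<forall>g\<in>linf G. (\<forall>s\<in>carrier G. cmod (g s) \<le> cmod (u s)) \<longrightarrow> g \<in> S)"

definition positive_functional ::
    "('g \<Rightarrow> complex) set \<Rightarrow> (('g \<Rightarrow> complex) \<Rightarrow> complex) \<Rightarrow> bool" where
  "positive_functional S \<mu> \<longleftrightarrow>
     (\<forall>g\<in>S. \<forall>h\<in>S. \<mu> (\<lambda>s. g s + h s) = \<mu> g + \<mu> h) \<and>
     (\<forall>c. \<forall>g\<in>S. \<mu> (\<lambda>s. c * g s) = c * \<mu> g) \<and>
     (\<forall>g\<in>S. (\<forall>s. 0 \<le> g s) \<longrightarrow> 0 \<le> \<mu> g)"

lemma invariant_integral_iff:
  "invariant_integral G S \<mu> \<longleftrightarrow> positive_functional S \<mu> \<and>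
     (\<forall>t\<in>carrier G. \<forall>g\<in>S. \<mu> (translate G t g) = \<mu> g)"
  by (auto simp: invariant_integral_def positive_functional_def)

lemma invariant_integral_subset:
  assumes "invariant_integral G T \<mu>" "S \<subseteq> T"
  shows "invariant_integral G S \<mu>"
  using assms(1) subsetD[OF assms(2)] by (simp add: invariant_integral_def)

lemma linf_bounded:
  assumes "g \<in> linf G"
  obtains B where "B > 0" "\<And>s. cmod (g s) \<le> B"
proof -
  from assms obtain B where B: "B > 0" "\<And>s. s \<in> carrier G \<Longrightarrow> cmod (g s) \<le> B"
    and z: "\<And>s. s \<notin> carrier G \<Longrightarrow> g s = 0"
    unfolding linf_def bounded_pos by auto
  have "cmod (g s) \<le> B" for s
    using B z by (cases "s \<in> carrier G") auto
  with B(1) show ?thesis using that by blast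
qed

lemma linfI:
  assumes "\<And>s. s \<notin> carrier G \<Longrightarrow> g s = 0" "\<And>s. s \<in> carrier G \<Longrightarrow> cmod (g s) \<le> B"
  shows "g \<in> linf G"
  using assms unfolding linf_def bounded_iff by auto

lemma linf_zero_outside: "g \<in> linf G \<Longrightarrow> s \<notin> carrier G \<Longrightarrow> g s = 0"
  by (simp add: linf_def)

lemma linf_zero: "(\<lambda>_. 0) \<in> linf G"
  by (rule linfI[where B = 0]) auto

lemma linf_add:
  assumes "g \<in> linf G" "h \<in> linf G"
  shows "(\<lambda>s. g s + h s) \<in> linf G"
proof -
  obtain A B where "\<And>s. cmod (g s) \<le> A" "\<And>s. cmod (h s) \<le> B"
    using linf_bounded[OF assms(1)] linf_bounded[OF assms(2)] by metis
  then show ?thesis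
    by (intro linfI[where B = "A + B"])
      (auto simp: linf_zero_outside[OF assms(1)] linf_zero_outside[OF assms(2)]
        intro: norm_triangle_le add_mono)
qed

lemma linf_mult:
  assumes "g \<in> linf G" "h \<in> linf G"
  shows "(\<lambda>s. g s * h s) \<in> linf G"
proof -
  obtain A B where "\<And>s. cmod (g s) \<le> A" "\<And>s. cmod (h s) \<le> B" "A > 0"
    using linf_bounded[OF assms(1)] linf_bounded[OF assms(2)] by metis
  then show ?thesis
    by (intro linfI[where B = "A * B"])
      (auto simp: linf_zero_outside[OF assms(1)] norm_mult intro!: mult_mono)
qed

lemma linf_scale:
  assumes "g \<in> linf G"
  shows "(\<lambda>s. c * g s) \<in> linf G"
proof -
  obtain A where "\<And>s. cmod (g s) \<le> A"
    using linf_bounded[OF assms] by metis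
  then show ?thesis
    by (intro linfI[where B = "cmod c * A"])
      (auto simp: linf_zero_outside[OF assms] norm_mult mult_left_mono)
qed

lemma linf_restrict:
  assumes "g \<in> linf G"
  shows "(\<lambda>s. if s \<in> E then g s else 0) \<in> linf G"
proof -
  obtain A where "\<And>s. cmod (g s) \<le> A" "A > 0"
    using linf_bounded[OF assms] by metis
  then show ?thesis
    by (intro linfI[where B = A])
      (auto simp: linf_zero_outside[OF assms] less_imp_le)
qed

lemma linf_indicator:
  assumes "E \<subseteq> carrier G"
  shows "(\<lambda>s. of_bool (s \<in> E)) \<in> linf G"
  using assms by (intro linfI[where B = 1]) auto

lemma (in group) translate_linf:
  assumes "g \<in> linf G" "t \<in> carrier G"
  shows "translate G t g \<in> linf G"
proof -
  obtain A where "\<And>s. cmod (g s) \<le> A"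
    using linf_bounded[OF assms(1)] by metis
  then show ?thesis
    by (intro linfI[where B = A]) (auto simp: translate_def)
qed

lemma (in group) translate_mult:
  assumes "t \<in> carrier G" "u \<in> carrier G"
  shows "translate G t (translate G u g) = translate G (t \<otimes> u) g"
  using assms by (auto simp: translate_def fun_eq_iff inv_mult_group m_assoc)

lemma (in group) translate_one:
  assumes "g \<in> linf G"
  shows "translate G \<one> g = g"
  using linf_zero_outside[OF assms] by (auto simp: translate_def fun_eq_iff)

lemma translate_add: "translate G t (\<lambda>s. g s + h s) = (\<lambda>s. translate G t g s + translate G t h s)"
  by (auto simp: translate_def)

lemma translate_scale: "translate G t (\<lambda>s. c * g s) = (\<lambda>s. c * translate G t g s)"
  by (auto simp: translate_def)

lemma translate_nonneg:
  fixes g :: "'g \<Rightarrow> complex"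
  shows "(\<And>s. 0 \<le> g s) \<Longrightarrow> 0 \<le> translate G t g s"
  by (auto simp: translate_def)

lemma solid_subspaceD:
  assumes "solid_subspace G S"
  shows "S \<subseteq> linf G" "(\<lambda>_. 0) \<in> S" "\<And>g h. g \<in> S \<Longrightarrow> h \<in> S \<Longrightarrow> (\<lambda>s. g s + h s) \<in> S"
    "\<And>c g. g \<in> S \<Longrightarrow> (\<lambda>s. c * g s) \<in> S"
    "\<And>u g. u \<in> S \<Longrightarrow> g \<in> linf G \<Longrightarrow> (\<And>s. s \<in> carrier G \<Longrightarrow> cmod (g s) \<le> cmod (u s)) \<Longrightarrow> g \<in> S"
  using assms unfolding solid_subspace_def by blast+

lemma positive_functionalD:
  assumes "positive_functional S \<mu>"
  shows "\<And>g h. g \<in> S \<Longrightarrow> h \<in> S \<Longrightarrow> \<mu> (\<lambda>s. g s + h s) = \<mu> g + \<mu> h"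
    "\<And>c g. g \<in> S \<Longrightarrow> \<mu> (\<lambda>s. c * g s) = c * \<mu> g"
    "\<And>g. g \<in> S \<Longrightarrow> (\<And>s. 0 \<le> g s) \<Longrightarrow> 0 \<le> \<mu> g"
  using assms unfolding positive_functional_def by auto

lemma positive_functional_zero:
  assumes "positive_functional S \<mu>" "(\<lambda>_. 0) \<in> S"
  shows "\<mu> (\<lambda>_. 0) = 0"
  using positive_functionalD(2)[OF assms, of 0] by simp

lemma positive_functional_sum:
  assumes "solid_subspace G S" "positive_functional S \<mu>" "finite I" "\<And>i. i \<in> I \<Longrightarrow> g i \<in> S"
  shows "(\<lambda>s. \<Sum>i\<in>I. g i s) \<in> S \<and> \<mu> (\<lambda>s. \<Sum>i\<in>I. g i s) = (\<Sum>i\<in>I. \<mu> (g i))"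
  using assms(3,4)
proof (induction I rule: finite_induct)
  case empty
  then show ?case
    using solid_subspaceD(2)[OF assms(1)] positive_functional_zero[OF assms(2)] by simp
next
  case (insert i I)
  then show ?case
    using solid_subspaceD(3)[OF assms(1), of "g i" "\<lambda>s. \<Sum>i\<in>I. g i s"]
      positive_functionalD(1)[OF assms(2), of "g i" "\<lambda>s. \<Sum>i\<in>I. g i s"] by simp
qed

lemma positive_functional_mono:
  assumes S: "solid_subspace G S" and \<mu>: "positive_functional S \<mu>"
    and "g \<in> linf G" "u \<in> S" and le: "\<And>s. s \<in> carrier G \<Longrightarrow> complex_of_real (cmod (g s)) \<le> u s"
  shows "Re (\<mu> g) \<le> Re (\<mu> u)"
proof -
  note SD = solid_subspaceD[OF S] and \<mu>D = positive_functionalD[OF \<mu>]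
  have "complex_of_real (cmod (g s)) \<le> u s" for s
    using le[of s] linf_zero_outside[of u G s] linf_zero_outside[of g G s] assms(3,4) SD(1)
    by (cases "s \<in> carrier G") auto
  then have u: "u s = complex_of_real (Re (u s))" "cmod (g s) \<le> Re (u s)" for s
    by (simp_all add: less_eq_complex_def complex_eq_iff)
  have cu: "cmod (u s) = Re (u s)" for s
  proof -
    have "0 \<le> Re (u s)" using u(2)[of s] norm_ge_zero order_trans by blast
    then show ?thesis using u(1)[of s] by (metis norm_of_real abs_of_nonneg)
  qed
  have gS: "g \<in> S"
    using SD(5)[OF \<open>u \<in> S\<close> \<open>g \<in> linf G\<close>] u(2) cu by simp
  define r i where "r = (\<lambda>s. complex_of_real (Re (g s)))"
    and "i = (\<lambda>s. complex_of_real (Im (g s)))"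
  obtain B where B: "\<And>s. cmod (g s) \<le> B"
    using linf_bounded[OF \<open>g \<in> linf G\<close>] by metis
  have lin: "r \<in> linf G" "i \<in> linf G"
    using order_trans[OF abs_Re_le_cmod B] order_trans[OF abs_Im_le_cmod B]
    by (auto intro!: linfI[where B = B] simp: r_def i_def linf_zero_outside[OF \<open>g \<in> linf G\<close>])
  have ri: "r \<in> S" "i \<in> S"
    using SD(5)[OF gS] lin by (auto simp: r_def i_def abs_Re_le_cmod abs_Im_le_cmod)
  have part: "0 \<le> \<mu> u - \<mu> h" if "h \<in> S" "\<And>s. h s = complex_of_real (Re (h s))"
    "\<And>s. \<bar>Re (h s)\<bar> \<le> cmod (g s)" for h
  proof -
    have "0 \<le> \<mu> (\<lambda>s. u s + (-1) * h s)"
    proof (intro \<mu>D(3) SD(3,4) \<open>u \<in> S\<close> \<open>h \<in> S\<close>)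
      fix s
      have "Re (h s) \<le> Re (u s)" using that(3)[of s] u(2)[of s] by linarith
      then show "0 \<le> u s + (-1) * h s"
        using u(1)[of s] that(2)[of s] by (auto simp: less_eq_complex_def complex_eq_iff)
    qed
    also have "\<mu> (\<lambda>s. u s + (-1) * h s) = \<mu> u - \<mu> h"
      using \<mu>D(1)[OF \<open>u \<in> S\<close> SD(4)[OF \<open>h \<in> S\<close>, of "-1"]] \<mu>D(2)[OF \<open>h \<in> S\<close>, of "-1"]
      by simp
    finally show ?thesis .
  qed
  have "0 \<le> u s" for s
    using u[of s] norm_ge_zero[of "g s"] by (simp add: less_eq_complex_def complex_eq_iff del: norm_ge_zero)
  then have "0 \<le> \<mu> u"
    using \<mu>D(3)[OF \<open>u \<in> S\<close>] by simp
  then have "Im (\<mu> i) = 0" "Re (\<mu> r) \<le> Re (\<mu> u)"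
    using part[of i] part[of r] ri
    by (auto simp: less_eq_complex_def r_def i_def abs_Re_le_cmod abs_Im_le_cmod)
  moreover have "\<mu> g = \<mu> r + \<i> * \<mu> i"
  proof -
    have "g = (\<lambda>s. r s + \<i> * i s)"
      by (auto simp: r_def i_def complex_eq_iff)
    then show ?thesis
      using \<mu>D(1)[OF ri(1) SD(4)[OF ri(2)], of \<i>] \<mu>D(2)[OF ri(2), of \<i>] by simp
  qed
  ultimately show ?thesis by simp
qed

lemma positive_functional_null:
  assumes S: "solid_subspace G S" and \<mu>: "positive_functional S \<mu>"
    and "g \<in> linf G" "u \<in> S" "\<And>s. s \<in> carrier G \<Longrightarrow> complex_of_real (cmod (g s)) \<le> u s" "\<mu> u = 0"
  shows "\<mu> g = 0"
proof -
  have "cmod (g s) \<le> cmod (u s)" if "s \<in> carrier G" for s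
    using assms(5)[OF that] complex_Re_le_cmod[of "u s"]
    by (auto simp: less_eq_complex_def)
  then have gS: "g \<in> S"
    using solid_subspaceD(5)[OF S \<open>u \<in> S\<close> \<open>g \<in> linf G\<close>] by simp
  have "Re (c * \<mu> g) \<le> 0" if "cmod c = 1" for c
    using positive_functional_mono[OF S \<mu> linf_scale[OF \<open>g \<in> linf G\<close>, of c] \<open>u \<in> S\<close>]
      positive_functionalD(2)[OF \<mu> gS, of c] assms(5,6) that by (simp add: norm_mult)
  from this[of 1] this[of "-1"] this[of \<i>] this[of "-\<i>"] show ?thesis
    by (simp add: complex_eq_iff)
qed

section \<open>The Pedersen ideal\<close>

locale positive_linf = group G for G (structure) +
  fixes f :: "'a \<Rightarrow> complex"
  assumes f_linf: "f \<in> linf G" and f_nonneg: "0 \<le> f s"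
begin

lemma Re_f_nonneg: "0 \<le> Re (f s)" and f_eq_Re: "f s = complex_of_real (Re (f s))"
  using f_nonneg[of s] by (auto simp: less_eq_complex_def complex_eq_iff)

lemma sum_translate:
  assumes "s \<in> carrier G"
  shows "(\<Sum>j\<in>I. translate G (t j) f s) = complex_of_real (\<Sum>j\<in>I. Re (f (inv (t j) \<otimes> s)))"
  using assms f_eq_Re[symmetric] by (simp add: translate_def)

lemma linf_dom_iff:
  "g \<in> linf_dom G f \<longleftrightarrow> g \<in> linf G \<and> (\<exists>F K. finite F \<and> F \<subseteq> carrier G \<and>
     (\<forall>s\<in>carrier G. cmod (g s) \<le> K * (\<Sum>t\<in>F. Re (f (inv t \<otimes> s)))))"
  (is "_ \<longleftrightarrow> _ \<and> ?dom")
proof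
  assume g: "g \<in> linf_dom G f"
  then obtain n and t :: "nat \<Rightarrow> 'a" where t: "\<And>j. j \<in> {1..n} \<Longrightarrow> t j \<in> carrier G"
    and le: "\<And>s. s \<in> carrier G \<Longrightarrow> complex_of_real (cmod (g s)) \<le> (\<Sum>j=1..n. translate G (t j) f s)"
    unfolding linf_dom_def by blast
  have "cmod (g s) \<le> real n * (\<Sum>u\<in>t ` {1..n}. Re (f (inv u \<otimes> s)))" if s: "s \<in> carrier G" for s
  proof -
    have "cmod (g s) \<le> (\<Sum>j=1..n. Re (f (inv (t j) \<otimes> s)))"
      using le[OF s] by (simp only: sum_translate[OF s] less_eq_complex_def Re_complex_of_real)
    also have "\<dots> \<le> (\<Sum>j=1..n. \<Sum>u\<in>t ` {1..n}. Re (f (inv u \<otimes> s)))"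
      by (rule sum_mono, rule member_le_sum) (auto simp: Re_f_nonneg)
    finally show ?thesis by simp
  qed
  then have ?dom
    using t by (intro exI[of _ "t ` {1..n}"] exI[of _ "real n"]) auto
  then show "g \<in> linf G \<and> ?dom"
    using g by (simp add: linf_dom_def)
next
  assume "g \<in> linf G \<and> ?dom"
  then obtain F K where g: "g \<in> linf G" and F: "finite F" "F \<subseteq> carrier G"
    and le: "\<And>s. s \<in> carrier G \<Longrightarrow> cmod (g s) \<le> K * (\<Sum>t\<in>F. Re (f (inv t \<otimes> s)))"
    by blast
  obtain N :: nat where N: "K \<le> real N"
    using real_arch_simple by blast
  define M where "M = insert \<one> F \<times> {..<Suc N}"
  have M: "finite M" "M \<noteq> {}" "fst ` M \<subseteq> carrier G"
    using F by (auto simp: M_def lessThan_Suc)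
  obtain h where h: "bij_betw h {1..card M} M"
    using ex_bij_betw_nat_finite_1[OF M(1)] by blast
  have "complex_of_real (cmod (g s)) \<le> (\<Sum>j=1..card M. translate G (fst (h j)) f s)"
    if s: "s \<in> carrier G" for s
  proof -
    have "cmod (g s) \<le> K * (\<Sum>t\<in>F. Re (f (inv t \<otimes> s)))"
      by (rule le[OF s])
    also have "\<dots> \<le> real (Suc N) * (\<Sum>t\<in>insert \<one> F. Re (f (inv t \<otimes> s)))"
      using F N by (intro mult_mono sum_mono2 sum_nonneg) (auto simp: Re_f_nonneg)
    also have "\<dots> = (\<Sum>p\<in>M. Re (f (inv (fst p) \<otimes> s)))"
      unfolding M_def
      using sum.cartesian_product[of "\<lambda>t (_ :: nat). Re (f (inv t \<otimes> s))" "{..<Suc N}" "insert \<one> F"]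
      by (simp only: sum_constant card_lessThan sum_distrib_left case_prod_unfold)
    also have "\<dots> = (\<Sum>j=1..card M. Re (f (inv (fst (h j)) \<otimes> s)))"
      using sum.reindex_bij_betw[OF h, of "\<lambda>p. Re (f (inv (fst p) \<otimes> s))"] by simp
    finally show ?thesis
      by (simp add: sum_translate[OF s] less_eq_complex_def)
  qed
  moreover have "card M \<ge> 1"
    using M by (simp add: Suc_le_eq card_gt_0_iff)
  moreover have "fst (h j) \<in> carrier G" if "j \<in> {1..card M}" for j
    using M(3) bij_betwE[OF h] that by blast
  ultimately show "g \<in> linf_dom G f"
    using g unfolding linf_dom_def
    by (intro CollectI conjI exI[of _ "card M"] exI[of _ "\<lambda>j. fst (h j)"]) blast+
qed

lemma linf_dom_subset: "linf_dom G f \<subseteq> linf G"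
  by (auto simp: linf_dom_def)

lemma linf_domI:
  assumes "g \<in> linf G" "finite F" "F \<subseteq> carrier G"
    "\<And>s. s \<in> carrier G \<Longrightarrow> cmod (g s) \<le> K * (\<Sum>t\<in>F. Re (f (inv t \<otimes> s)))"
  shows "g \<in> linf_dom G f"
  using assms linf_dom_iff by blast

lemma linf_domD:
  assumes "g \<in> linf_dom G f"
  shows "\<exists>F K. finite F \<and> F \<subseteq> carrier G \<and> K \<ge> 0 \<and>
    (\<forall>s\<in>carrier G. cmod (g s) \<le> K * (\<Sum>t\<in>F. Re (f (inv t \<otimes> s))))"
proof -
  from assms obtain F K where F: "finite F" "F \<subseteq> carrier G"
    "\<And>s. s \<in> carrier G \<Longrightarrow> cmod (g s) \<le> K * (\<Sum>t\<in>F. Re (f (inv t \<otimes> s)))"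
    unfolding linf_dom_iff by blast
  have "cmod (g s) \<le> \<bar>K\<bar> * (\<Sum>t\<in>F. Re (f (inv t \<otimes> s)))" if "s \<in> carrier G" for s
    using F(3)[OF that] by (rule order_trans) (intro mult_right_mono sum_nonneg, auto simp: Re_f_nonneg)
  then show ?thesis
    using F(1,2) abs_ge_zero by blast
qed

lemma solid_linf_dom: "solid_subspace G (linf_dom G f)"
  unfolding solid_subspace_def
proof (intro conjI ballI allI impI)
  show "linf_dom G f \<subseteq> linf G" by (rule linf_dom_subset)
  show "(\<lambda>_. 0) \<in> linf_dom G f"
    by (rule linf_domI[of _ "{}" 0]) (auto simp: linf_zero)
next
  fix g h assume gh: "g \<in> linf_dom G f" "h \<in> linf_dom G f"
  obtain F K where F: "finite F" "F \<subseteq> carrier G" "K \<ge> 0"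
    "\<And>s. s \<in> carrier G \<Longrightarrow> cmod (g s) \<le> K * (\<Sum>t\<in>F. Re (f (inv t \<otimes> s)))"
    using linf_domD[OF gh(1)] by blast
  obtain E L where E: "finite E" "E \<subseteq> carrier G" "L \<ge> 0"
    "\<And>s. s \<in> carrier G \<Longrightarrow> cmod (h s) \<le> L * (\<Sum>t\<in>E. Re (f (inv t \<otimes> s)))"
    using linf_domD[OF gh(2)] by blast
  show "(\<lambda>s. g s + h s) \<in> linf_dom G f"
  proof (rule linf_domI[of _ "F \<union> E" "K + L"])
    show "(\<lambda>s. g s + h s) \<in> linf G"
      using gh linf_dom_subset by (intro linf_add) auto
    fix s assume s: "s \<in> carrier G"
    have "K * (\<Sum>t\<in>F. Re (f (inv t \<otimes> s))) \<le> K * (\<Sum>t\<in>F \<union> E. Re (f (inv t \<otimes> s)))"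
      "L * (\<Sum>t\<in>E. Re (f (inv t \<otimes> s))) \<le> L * (\<Sum>t\<in>F \<union> E. Re (f (inv t \<otimes> s)))"
      using F E by (auto intro!: mult_left_mono sum_mono2 simp: Re_f_nonneg)
    then show "cmod (g s + h s) \<le> (K + L) * (\<Sum>t\<in>F \<union> E. Re (f (inv t \<otimes> s)))"
      using norm_triangle_ineq[of "g s" "h s"] F(4)[OF s] E(4)[OF s]
      by (simp only: distrib_right)
  qed (use F(1,2) E(1,2) in auto)
next
  fix c g assume g: "g \<in> linf_dom G f"
  obtain F K where F: "finite F" "F \<subseteq> carrier G" "K \<ge> 0"
    "\<And>s. s \<in> carrier G \<Longrightarrow> cmod (g s) \<le> K * (\<Sum>t\<in>F. Re (f (inv t \<otimes> s)))"
    using linf_domD[OF g] by blast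
  show "(\<lambda>s. c * g s) \<in> linf_dom G f"
  proof (rule linf_domI[of _ F "cmod c * K"])
    show "(\<lambda>s. c * g s) \<in> linf G"
      using g linf_dom_subset by (intro linf_scale) auto
    show "cmod (c * g s) \<le> cmod c * K * (\<Sum>t\<in>F. Re (f (inv t \<otimes> s)))" if "s \<in> carrier G" for s
      using mult_left_mono[OF F(4)[OF that], of "cmod c"] by (simp only: norm_mult mult.assoc norm_ge_zero)
  qed (use F(1,2) in auto)
next
  fix u g assume u: "u \<in> linf_dom G f" and g: "g \<in> linf G" "\<forall>s\<in>carrier G. cmod (g s) \<le> cmod (u s)"
  obtain F K where F: "finite F" "F \<subseteq> carrier G" "K \<ge> 0"
    "\<And>s. s \<in> carrier G \<Longrightarrow> cmod (u s) \<le> K * (\<Sum>t\<in>F. Re (f (inv t \<otimes> s)))"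
    using linf_domD[OF u] by blast
  show "g \<in> linf_dom G f"
    by (rule linf_domI[OF g(1) F(1,2)]) (use F(4) g(2) in \<open>blast intro: order_trans\<close>)
qed

lemma translate_f_linf_dom:
  assumes "t \<in> carrier G"
  shows "translate G t f \<in> linf_dom G f"
proof (rule linf_domI[of _ "{t}" 1])
  show "translate G t f \<in> linf G"
    by (rule translate_linf[OF f_linf assms])
  fix s assume s: "s \<in> carrier G"
  have "cmod (f (inv t \<otimes> s)) = Re (f (inv t \<otimes> s))"
    by (subst f_eq_Re) (simp only: norm_of_real abs_of_nonneg[OF Re_f_nonneg])
  then show "cmod (translate G t f s) \<le> 1 * (\<Sum>t\<in>{t}. Re (f (inv t \<otimes> s)))"
    using s by (simp add: translate_def)
qed (use assms in auto)

lemma f_linf_dom: "f \<in> linf_dom G f"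
  using translate_f_linf_dom[OF one_closed] translate_one[OF f_linf] by simp

lemma translate_linf_dom:
  assumes "g \<in> linf_dom G f" "u \<in> carrier G"
  shows "translate G u g \<in> linf_dom G f"
proof -
  obtain F K where F: "finite F" "F \<subseteq> carrier G" "K \<ge> 0"
    "\<And>s. s \<in> carrier G \<Longrightarrow> cmod (g s) \<le> K * (\<Sum>t\<in>F. Re (f (inv t \<otimes> s)))"
    using linf_domD[OF assms(1)] by blast
  show ?thesis
  proof (rule linf_domI[of _ "(\<lambda>t. u \<otimes> t) ` F" K])
    show "translate G u g \<in> linf G"
      using assms linf_dom_subset by (intro translate_linf) auto
    fix s assume s: "s \<in> carrier G"
    have "(\<Sum>t\<in>(\<lambda>t. u \<otimes> t) ` F. Re (f (inv t \<otimes> s))) = (\<Sum>t\<in>F. Re (f (inv (u \<otimes> t) \<otimes> s)))"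
      using F(2) assms(2) by (subst sum.reindex) (auto intro!: inj_onI simp: subset_iff)
    also have "\<dots> = (\<Sum>t\<in>F. Re (f (inv t \<otimes> (inv u \<otimes> s))))"
      using F(2) assms(2) s by (intro sum.cong) (auto simp: inv_mult_group m_assoc subset_iff)
    finally show "cmod (translate G u g s) \<le> K * (\<Sum>t\<in>(\<lambda>t. u \<otimes> t) ` F. Re (f (inv t \<otimes> s)))"
      using F(4)[of "inv u \<otimes> s"] s assms(2) by (simp add: translate_def)
  qed (use F(1,2) assms in auto)
qed

definition superlevel :: "'a set \<Rightarrow> real \<Rightarrow> 'a set" where
  "superlevel F \<epsilon> = {s \<in> carrier G. \<exists>t\<in>F. \<epsilon> \<le> Re (f (inv t \<otimes> s))}"

text \<open>On the spectrum of the C*-algebra generated by \<open>linf_dom G f\<close> these are the continuous functions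
  with compact support.\<close>

definition linf_cpt :: "('a \<Rightarrow> complex) set" where
  "linf_cpt = {g \<in> linf G. \<exists>F \<epsilon>. finite F \<and> F \<subseteq> carrier G \<and> \<epsilon> > 0 \<and>
     (\<forall>s. g s \<noteq> 0 \<longrightarrow> s \<in> superlevel F \<epsilon>)}"

lemma linf_cptI:
  assumes "g \<in> linf G" "finite F" "F \<subseteq> carrier G" "\<epsilon> > 0" "\<And>s. g s \<noteq> 0 \<Longrightarrow> s \<in> superlevel F \<epsilon>"
  shows "g \<in> linf_cpt"
  using assms unfolding linf_cpt_def by blast

lemma linf_cptD:
  assumes "g \<in> linf_cpt"
  shows "\<exists>F \<epsilon>. finite F \<and> F \<subseteq> carrier G \<and> \<epsilon> > 0 \<and> (\<forall>s. g s \<noteq> 0 \<longrightarrow> s \<in> superlevel F \<epsilon>)"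
  using assms unfolding linf_cpt_def by blast

lemma linf_cpt_subset: "linf_cpt \<subseteq> linf G"
  by (auto simp: linf_cpt_def)

lemma linf_cpt_support_mono:
  assumes "u \<in> linf_cpt" "g \<in> linf G" "\<And>s. g s \<noteq> 0 \<Longrightarrow> u s \<noteq> 0"
  shows "g \<in> linf_cpt"
  using assms unfolding linf_cpt_def by blast

lemma solid_linf_cpt: "solid_subspace G linf_cpt"
  unfolding solid_subspace_def
proof (intro conjI ballI allI impI)
  show "linf_cpt \<subseteq> linf G" by (rule linf_cpt_subset)
  show "(\<lambda>_. 0) \<in> linf_cpt"
    by (rule linf_cptI[of _ "{}" 1]) (auto simp: linf_zero)
next
  fix g h assume gh: "g \<in> linf_cpt" "h \<in> linf_cpt"
  obtain F \<epsilon> where F: "finite F" "F \<subseteq> carrier G" "\<epsilon> > 0" "\<And>s. g s \<noteq> 0 \<Longrightarrow> s \<in> superlevel F \<epsilon>"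
    using linf_cptD[OF gh(1)] by blast
  obtain E \<delta> where E: "finite E" "E \<subseteq> carrier G" "\<delta> > 0" "\<And>s. h s \<noteq> 0 \<Longrightarrow> s \<in> superlevel E \<delta>"
    using linf_cptD[OF gh(2)] by blast
  show "(\<lambda>s. g s + h s) \<in> linf_cpt"
  proof (rule linf_cptI[of _ "F \<union> E" "min \<epsilon> \<delta>"])
    show "(\<lambda>s. g s + h s) \<in> linf G"
      using gh linf_cpt_subset by (intro linf_add) auto
    fix s assume "g s + h s \<noteq> 0"
    then have "s \<in> superlevel F \<epsilon> \<union> superlevel E \<delta>"
      using F(4)[of s] E(4)[of s] by (cases "g s = 0") auto
    then show "s \<in> superlevel (F \<union> E) (min \<epsilon> \<delta>)"
      by (fastforce simp: superlevel_def min_le_iff_disj)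
  qed (use F(1-3) E(1-3) in auto)
next
  fix c g assume g: "g \<in> linf_cpt"
  show "(\<lambda>s. c * g s) \<in> linf_cpt"
    by (rule linf_cpt_support_mono[OF g linf_scale]) (use g linf_cpt_subset in auto)
next
  fix u g assume u: "u \<in> linf_cpt" and g: "g \<in> linf G" "\<forall>s\<in>carrier G. cmod (g s) \<le> cmod (u s)"
  have "u s \<noteq> 0" if "g s \<noteq> 0" for s
    using that g linf_zero_outside[OF g(1)] by force
  then show "g \<in> linf_cpt"
    by (rule linf_cpt_support_mono[OF u g(1)])
qed

lemma linf_cpt_subset_linf_dom: "linf_cpt \<subseteq> linf_dom G f"
proof
  fix g assume g: "g \<in> linf_cpt"
  obtain F \<epsilon> where F: "finite F" "F \<subseteq> carrier G" "\<epsilon> > 0" "\<And>s. g s \<noteq> 0 \<Longrightarrow> s \<in> superlevel F \<epsilon>"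
    using linf_cptD[OF g] by blast
  have gl: "g \<in> linf G" using g linf_cpt_subset by blast
  obtain B where B: "B > 0" "\<And>s. cmod (g s) \<le> B"
    using linf_bounded[OF gl] by metis
  show "g \<in> linf_dom G f"
  proof (rule linf_domI[OF gl F(1,2), of "B / \<epsilon>"])
    fix s assume s: "s \<in> carrier G"
    show "cmod (g s) \<le> B / \<epsilon> * (\<Sum>t\<in>F. Re (f (inv t \<otimes> s)))"
    proof (cases "g s = 0")
      case True
      then show ?thesis using B(1) F(3) by (simp add: sum_nonneg Re_f_nonneg)
    next
      case False
      then obtain t where t: "t \<in> F" "\<epsilon> \<le> Re (f (inv t \<otimes> s))"
        using F(4) by (auto simp: superlevel_def)
      have "Re (f (inv t \<otimes> s)) \<le> (\<Sum>t\<in>F. Re (f (inv t \<otimes> s)))"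
        by (rule member_le_sum) (use t F Re_f_nonneg in auto)
      then have "\<epsilon> \<le> (\<Sum>t\<in>F. Re (f (inv t \<otimes> s)))"
        using t by linarith
      then have "B / \<epsilon> * \<epsilon> \<le> B / \<epsilon> * (\<Sum>t\<in>F. Re (f (inv t \<otimes> s)))"
        using B(1) F(3) by (intro mult_left_mono) auto
      then show ?thesis using B(2)[of s] F(3) by simp
    qed
  qed
qed

lemma linf_cpt_dense:
  assumes g: "g \<in> linf_dom G f" and "\<epsilon> > 0"
  shows "\<exists>h\<in>linf_cpt. \<forall>s\<in>carrier G. cmod (g s - h s) \<le> \<epsilon>"
proof -
  obtain F K where F: "finite F" "F \<subseteq> carrier G" "K \<ge> 0"
    "\<And>s. s \<in> carrier G \<Longrightarrow> cmod (g s) \<le> K * (\<Sum>t\<in>F. Re (f (inv t \<otimes> s)))"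
    using linf_domD[OF g] by blast
  define \<delta> where "\<delta> = \<epsilon> / (1 + K * card F)"
  have pos: "1 + K * card F > 0" using F(3) by (intro add_pos_nonneg) auto
  then have \<delta>: "\<delta> > 0" using \<open>\<epsilon> > 0\<close> by (simp add: \<delta>_def)
  define h where "h = (\<lambda>s. if s \<in> superlevel F \<delta> then g s else 0)"
  have "h \<in> linf_cpt"
    by (rule linf_cptI[OF _ F(1,2) \<delta>])
      (use g linf_dom_subset in \<open>auto simp: h_def intro!: linf_restrict split: if_splits\<close>)
  moreover have "cmod (g s - h s) \<le> \<epsilon>" if s: "s \<in> carrier G" for s
  proof (cases "s \<in> superlevel F \<delta>")
    case True
    then show ?thesis using \<open>\<epsilon> > 0\<close> by (simp add: h_def)
  next
    case False
    then have "(\<Sum>t\<in>F. Re (f (inv t \<otimes> s))) \<le> card F * \<delta>"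
      using s by (intro sum_bounded_above) (force simp: superlevel_def)
    then have "cmod (g s) \<le> K * (card F * \<delta>)"
      using F(4)[OF s] F(3) mult_left_mono order_trans by blast
    also have "\<dots> \<le> (1 + K * card F) * \<delta>"
      using \<delta> by (simp add: algebra_simps)
    also have "\<dots> = \<epsilon>"
      using pos by (simp add: \<delta>_def)
    finally show ?thesis using False by (simp add: h_def)
  qed
  ultimately show ?thesis by blast
qed

theorem linf_c_eq_linf_cpt: "linf_c G f = linf_cpt"
proof -
  define A where "A = unif_closure G (linf_dom G f)"
  note cpt = solid_subspaceD[OF solid_linf_cpt]
  have dom_A: "linf_dom G f \<subseteq> A"
    using linf_dom_subset unfolding A_def unif_closure_def by (force intro: less_imp_le)
  have "dense_ideal G A linf_cpt"
    unfolding dense_ideal_def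
  proof (intro conjI ballI allI)
    show "linf_cpt \<subseteq> A"
      using dom_A linf_cpt_subset_linf_dom by blast
    show "(\<lambda>s. a s * g s) \<in> linf_cpt" if "a \<in> A" "g \<in> linf_cpt" for a g
      by (rule linf_cpt_support_mono[OF that(2) linf_mult])
        (use that linf_cpt_subset in \<open>auto simp: A_def unif_closure_def\<close>)
    show "A \<subseteq> unif_closure G linf_cpt"
    proof
      fix g assume g: "g \<in> A"
      have "\<exists>k\<in>linf_cpt. \<forall>s\<in>carrier G. cmod (g s - k s) \<le> \<epsilon>" if "\<epsilon> > 0" for \<epsilon>
      proof -
        have "\<epsilon> / 2 > 0" using that by simp
        then obtain h where h: "h \<in> linf_dom G f" "\<And>s. s \<in> carrier G \<Longrightarrow> cmod (g s - h s) \<le> \<epsilon> / 2"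
          using g unfolding A_def unif_closure_def by blast
        obtain k where k: "k \<in> linf_cpt" "\<And>s. s \<in> carrier G \<Longrightarrow> cmod (h s - k s) \<le> \<epsilon> / 2"
          using linf_cpt_dense[OF h(1) \<open>\<epsilon> / 2 > 0\<close>] by blast
        have "cmod (g s - k s) \<le> \<epsilon>" if "s \<in> carrier G" for s
          using norm_triangle_ineq[of "g s - h s" "h s - k s"] h(2)[OF that] k(2)[OF that] by simp
        then show ?thesis using k(1) by blast
      qed
      then show "g \<in> unif_closure G linf_cpt"
        using g unfolding A_def unif_closure_def by blast
    qed
  qed (use cpt in auto)
  moreover have "linf_cpt \<subseteq> J" if J: "dense_ideal G A J" for J
  proof
    fix g assume g: "g \<in> linf_cpt"
    define E where "E = {s \<in> carrier G. g s \<noteq> 0}"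
    obtain F \<epsilon> where F: "finite F" "F \<subseteq> carrier G" "\<epsilon> > 0" "\<And>s. g s \<noteq> 0 \<Longrightarrow> s \<in> superlevel F \<epsilon>"
      using linf_cptD[OF g] by blast
    have "(\<lambda>s. of_bool (s \<in> E)) \<in> linf_cpt"
      by (rule linf_cptI[OF linf_indicator F(1-3)]) (use F(4) in \<open>auto simp: E_def\<close>)
    then have "(\<lambda>s. of_bool (s \<in> E)) \<in> unif_closure G J"
      using J dom_A linf_cpt_subset_linf_dom unfolding dense_ideal_def by blast
    then obtain h where h: "h \<in> J" "\<And>s. s \<in> carrier G \<Longrightarrow> cmod (of_bool (s \<in> E) - h s) \<le> 1 / 2"
      unfolding unif_closure_def by (auto dest!: spec[of _ "1 / 2"])
    have large: "cmod (h s) \<ge> 1 / 2" if "s \<in> E" for s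
    proof -
      have "cmod (1 - h s) \<le> 1 / 2" using h(2)[of s] that by (simp add: E_def)
      then show ?thesis using norm_triangle_ineq2[of 1 "1 - h s"] by simp
    qed
    \<comment> \<open>\<open>h\<close> is bounded away from \<open>0\<close> on the support of \<open>g\<close>, so \<open>g\<close> is a multiple of it;
      off the support \<open>g s / h s\<close> is \<open>0\<close> even where \<open>h\<close> vanishes.\<close>
    define a where "a = (\<lambda>s. g s / h s)"
    have "cmod (a s) \<le> cmod (2 * g s)" for s
    proof (cases "s \<in> E")
      case True
      have "cmod (g s) * 1 \<le> cmod (g s) * (2 * cmod (h s))"
        using large[OF True] by (intro mult_left_mono) auto
      then show ?thesis
        using large[OF True] by (auto simp: a_def norm_divide norm_mult divide_simps mult_ac)
    next
      case False
      then have "g s = 0"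
        using linf_zero_outside[of g G s] g linf_cpt_subset by (auto simp: E_def)
      then show ?thesis by (simp add: a_def)
    qed
    moreover have "a \<in> linf G"
    proof -
      obtain B where "\<And>s. cmod (2 * g s) \<le> B"
        using linf_bounded[of "\<lambda>s. 2 * g s" G] linf_scale[of g G 2] g linf_cpt_subset by blast
      then show ?thesis
        using \<open>\<And>s. cmod (a s) \<le> cmod (2 * g s)\<close> linf_zero_outside[of g G] g linf_cpt_subset
        by (intro linfI[where B = B]) (auto simp: a_def intro: order_trans)
    qed
    ultimately have "a \<in> linf_cpt"
      using cpt(5)[OF cpt(4)[OF g, of 2]] by blast
    then have "(\<lambda>s. a s * h s) \<in> J"
      using J h(1) dom_A linf_cpt_subset_linf_dom unfolding dense_ideal_def by blast
    moreover have "(\<lambda>s. a s * h s) = g"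
    proof
      fix s
      show "a s * h s = g s"
      proof (cases "s \<in> E")
        case True
        then show ?thesis using large[OF True] by (auto simp: a_def)
      next
        case False
        then show ?thesis
          using linf_zero_outside[of g G s] g linf_cpt_subset by (auto simp: E_def a_def)
      qed
    qed
    ultimately show "g \<in> J" by simp
  qed
  ultimately show ?thesis
    unfolding linf_c_def pedersen_ideal_def A_def[symmetric] by (rule Least_equality)
qed

end

section \<open>Free sequences and the vanishing of integrals\<close>

lemma (in positive_linf) translate_linf_cpt:
  assumes "g \<in> linf_cpt" "u \<in> carrier G"
  shows "translate G u g \<in> linf_cpt"
proof -
  obtain F \<epsilon> where F: "finite F" "F \<subseteq> carrier G" "\<epsilon> > 0" "\<And>s. g s \<noteq> 0 \<Longrightarrow> s \<in> superlevel F \<epsilon>"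
    using linf_cptD[OF assms(1)] by blast
  show ?thesis
  proof (rule linf_cptI[of _ "(\<lambda>t. u \<otimes> t) ` F" \<epsilon>])
    show "translate G u g \<in> linf G"
      using assms linf_cpt_subset by (intro translate_linf) auto
    fix s assume "translate G u g s \<noteq> 0"
    then have s: "s \<in> carrier G" "inv u \<otimes> s \<in> superlevel F \<epsilon>"
      using F(4) by (auto simp: translate_def split: if_splits)
    then obtain t where t: "t \<in> F" "\<epsilon> \<le> Re (f (inv t \<otimes> (inv u \<otimes> s)))"
      by (auto simp: superlevel_def)
    moreover have "inv t \<otimes> (inv u \<otimes> s) = inv (u \<otimes> t) \<otimes> s"
      using t(1) F(2) s(1) assms(2) by (auto simp: inv_mult_group m_assoc subset_iff)
    ultimately show "s \<in> superlevel ((\<lambda>t. u \<otimes> t) ` F) \<epsilon>"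
      using s(1) by (auto simp: superlevel_def)
  qed (use F(1-3) assms in auto)
qed

primrec word :: "('g, 'b) monoid_scheme \<Rightarrow> (nat \<Rightarrow> 'g) \<Rightarrow> nat list \<Rightarrow> 'g" where
  "word G x [] = \<one>\<^bsub>G\<^esub>"
| "word G x (i # w) = x i \<otimes>\<^bsub>G\<^esub> word G x w"

definition increasing_lists :: "nat list set" where
  "increasing_lists = {w. sorted_wrt (<) w}"

lemma (in group) word_closed:
  "(\<And>k. x k \<in> carrier G) \<Longrightarrow> word G x w \<in> carrier G"
  by (induction w) auto

lemma (in group) word_snoc:
  assumes "\<And>k. x k \<in> carrier G"
  shows "word G x (w @ [k]) = word G x w \<otimes> x k"
  using assms by (induction w) (auto simp: word_closed m_assoc)

lemma increasing_below_Suc: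
  assumes "w \<in> increasing_lists" "set w \<subseteq> {..<Suc k}"
  obtains "set w \<subseteq> {..<k}"
  | v where "w = v @ [k]" "v \<in> increasing_lists" "set v \<subseteq> {..<k}"
proof (cases w rule: rev_cases)
  case Nil
  then show ?thesis using that(1) by simp
next
  case (snoc v m)
  then have v: "v \<in> increasing_lists" "set v \<subseteq> {..<m}" "m \<le> k"
    using assms by (auto simp: increasing_lists_def sorted_wrt_append)
  show ?thesis
  proof (cases "m = k")
    case True
    then show ?thesis using v snoc that(2) by blast
  next
    case False
    then have "set w \<subseteq> {..<k}" using v snoc by auto
    then show ?thesis by (rule that(1))
  qed
qed

lemma (in group) ex_fresh:
  assumes "infinite (carrier G)" "finite A" "A \<subseteq> carrier G"
  shows "\<exists>y\<in>carrier G. \<forall>a\<in>A. \<forall>b\<in>A. a \<otimes> y \<noteq> b"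
proof -
  define Q where "Q = (\<lambda>(a, b). inv a \<otimes> b) ` (A \<times> A)"
  have "finite Q"
    using assms(2) by (simp add: Q_def)
  then have "carrier G - Q \<noteq> {}"
    using assms(1) by (metis Diff_infinite_finite finite.emptyI)
  then obtain y where y: "y \<in> carrier G" "y \<notin> Q"
    by blast
  have "a \<otimes> y \<noteq> b" if "a \<in> A" "b \<in> A" for a b
  proof
    assume "a \<otimes> y = b"
    then have "y = inv a \<otimes> b"
      using that y(1) assms(3) by (metis inv_solve_left subsetD m_closed)
    then have "y \<in> Q"
      using that by (auto simp: Q_def)
    then show False using y(2) by blast
  qed
  then show ?thesis using y(1) by blast
qed

lemma (in group) ex_free_sequence:
  assumes "infinite (carrier G)"
  shows "\<exists>x :: nat \<Rightarrow> 'a. (\<forall>k. x k \<in> carrier G) \<and> inj_on (word G x) increasing_lists"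
proof -
  define fresh where "fresh A = (SOME y. y \<in> carrier G \<and> (\<forall>a\<in>A. \<forall>b\<in>A. a \<otimes> y \<noteq> b))" for A
  have fresh: "fresh A \<in> carrier G" "\<And>a b. a \<in> A \<Longrightarrow> b \<in> A \<Longrightarrow> a \<otimes> fresh A \<noteq> b"
    if "finite A" "A \<subseteq> carrier G" for A
    using someI_ex[OF ex_fresh[OF assms that, unfolded Bex_def]] unfolding fresh_def by blast+
  define P where "P = rec_nat {\<one>} (\<lambda>_ A. A \<union> (\<lambda>a. a \<otimes> fresh A) ` A)"
  define x where "x k = fresh (P k)" for k
  have P: "P 0 = {\<one>}" "\<And>k. P (Suc k) = P k \<union> (\<lambda>a. a \<otimes> x k) ` P k"
    by (simp_all add: P_def x_def)
  have fin: "finite (P k) \<and> P k \<subseteq> carrier G" for k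
  proof (induction k)
    case (Suc k)
    then show ?case using fresh(1)[of "P k"] by (auto simp: P x_def)
  qed (simp add: P)
  have x: "x k \<in> carrier G" for k
    using fresh(1) fin by (simp add: x_def)
  have word_P: "word G x w \<in> P k" if "w \<in> increasing_lists" "set w \<subseteq> {..<k}" for w k
    using that
  proof (induction k arbitrary: w)
    case (Suc k)
    show ?case
      using Suc.prems
    proof (cases rule: increasing_below_Suc)
      case 1
      then show ?thesis using Suc by (simp add: P)
    next
      case (2 v)
      then show ?thesis using Suc.IH[of v] by (auto simp: P word_snoc[OF x])
    qed
  qed (simp add: P)
  have inj: "v = w" if "v \<in> increasing_lists" "w \<in> increasing_lists" "set v \<subseteq> {..<k}" "set w \<subseteq> {..<k}"
    "word G x v = word G x w" for v w k
    using that
  proof (induction k arbitrary: v w)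
    case (Suc k)
    have ne: "word G x u \<otimes> x k \<noteq> word G x u'"
      if "u \<in> increasing_lists" "set u \<subseteq> {..<k}" "u' \<in> increasing_lists" "set u' \<subseteq> {..<k}" for u u'
      using fresh(2)[of "P k"] fin[of k] word_P[OF that(1,2)] word_P[OF that(3,4)] by (simp add: x_def)
    show ?case
      using Suc.prems(1,3)
    proof (cases rule: increasing_below_Suc)
      case v: 1
      show ?thesis
        using Suc.prems(2,4)
      proof (cases rule: increasing_below_Suc)
        case 1
        then show ?thesis using Suc v by blast
      next
        case (2 w')
        then show ?thesis
          using ne[of w' v] Suc.prems v by (simp add: word_snoc[OF x])
      qed
    next
      case v: (2 v')
      show ?thesis
        using Suc.prems(2,4)
      proof (cases rule: increasing_below_Suc)
        case 1
        then show ?thesis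
          using ne[of v' w] Suc.prems v by (simp add: word_snoc[OF x])
      next
        case (2 w')
        then have "word G x v' = word G x w'"
          using v Suc.prems(5) word_closed[of x, OF x] x by (simp add: word_snoc[OF x])
        then show ?thesis using Suc.IH[of v' w'] v 2 by simp
      qed
    qed
  qed simp
  have "inj_on (word G x) increasing_lists"
  proof (rule inj_onI)
    fix v w assume vw: "v \<in> increasing_lists" "w \<in> increasing_lists" "word G x v = word G x w"
    define k where "k = Suc (Max (insert 0 (set v \<union> set w)))"
    have "set v \<subseteq> {..<k}" "set w \<subseteq> {..<k}"
      by (auto simp: k_def less_Suc_eq_le)
    then show "v = w" using inj vw by blast
  qed
  with x show ?thesis by blast
qed

text \<open>Here \<open>b n i\<close> is going to be the measure of the set of words of length \<open>n\<close> in the letters with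
  indices from \<open>i\<close> on, split according to whether the letter \<open>i\<close> occurs.\<close>

lemma shifted_recurrence_zero:
  fixes b :: "nat \<Rightarrow> nat \<Rightarrow> real"
  assumes nonneg: "\<And>n i. 0 \<le> b n i" and const: "\<And>i. b 0 i = b 0 0"
    and rec: "\<And>n i. b (Suc n) i = b n (Suc i) + b (Suc n) (Suc i)"
  shows "b n i = 0"
proof -
  have zero: "a = 0" if a: "\<And>i. b n i = a" for n a
  proof -
    have sum: "b (Suc n) 0 = real N * a + b (Suc n) N" for N
    proof (induction N)
      case (Suc N)
      then show ?case using rec[of n N] a by (simp add: algebra_simps)
    qed simp
    have le: "real N * a \<le> b (Suc n) 0" for N
      using sum[of N] nonneg[of "Suc n" N] by simp
    show "a = 0"
    proof (rule ccontr)
      assume "a \<noteq> 0"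
      then have "a > 0" using nonneg[of n 0] a by simp
      then show False
        using reals_Archimedean3[of a] le by (meson not_le)
    qed
  qed
  have "\<exists>a. \<forall>i. b n i = a" for n
  proof (induction n)
    case 0
    then show ?case using const by blast
  next
    case (Suc n)
    then obtain a where "\<And>i. b n i = a" by blast
    with zero have b: "\<And>i. b n i = 0" by blast
    have "b (Suc n) i = b (Suc n) 0" for i
    proof (induction i)
      case (Suc i)
      then show ?case using rec[of n i] b by simp
    qed simp
    then show ?case by blast
  qed
  then show ?thesis using zero by metis
qed

theorem (in group) ex_positive_linf_no_integral:
  assumes "infinite (carrier G)"
  shows "\<exists>f. positive_linf G f \<and> f \<noteq> (\<lambda>_. 0) \<and>
    (\<forall>\<mu>. invariant_integral G (linf_c G f) \<mu> \<longrightarrow> (\<forall>g\<in>linf_c G f. \<mu> g = 0))"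
proof -
  obtain x :: "nat \<Rightarrow> 'a" where "\<forall>k. x k \<in> carrier G" and inj: "inj_on (word G x) increasing_lists"
    using ex_free_sequence[OF assms] by blast
  then have x: "x k \<in> carrier G" for k by simp
  define f where "f s = (if s \<in> word G x ` increasing_lists
    then complex_of_real (1 / real (Suc (length (inv_into increasing_lists (word G x) s)))) else 0)" for s
  have f_word: "f (word G x w) = complex_of_real (1 / real (Suc (length w)))" if "w \<in> increasing_lists" for w
    using inv_into_f_f[OF inj that] imageI[OF that, of "word G x"] by (simp only: f_def if_True)
  have f0: "f s = 0" if "s \<notin> word G x ` increasing_lists" for s
    using that by (simp only: f_def if_False)
  interpret f: positive_linf G f
  proof
    have f: "\<exists>r. f s = complex_of_real r \<and> 0 \<le> r \<and> r \<le> 1" for s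
    proof (cases "s \<in> word G x ` increasing_lists")
      case True
      then show ?thesis using f_word by (fastforce simp: divide_simps)
    qed (simp add: f0)
    show "f \<in> linf G"
    proof (rule linfI[where B = 1])
      show "f s = 0" if "s \<notin> carrier G" for s
        using that word_closed[of x, OF x] by (intro f0) auto
      show "cmod (f s) \<le> 1" for s
        using f[of s] by auto
    qed
    show "0 \<le> f s" for s
      using f[of s] by (auto simp: less_eq_complex_def)
  qed
  define W where "W n i = word G x ` {w \<in> increasing_lists. length w = n \<and> (\<forall>j\<in>set w. i \<le> j)}" for n i
  have W_carrier: "W n i \<subseteq> carrier G" for n i
    using word_closed[of x, OF x] by (auto simp: W_def)
  define ind :: "'a set \<Rightarrow> 'a \<Rightarrow> complex" where "ind E = (\<lambda>s. of_bool (s \<in> E))" for E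
  have ind_W: "ind (W n i) \<in> f.linf_cpt" for n i
  proof (rule f.linf_cptI[of _ "{\<one>}" "1 / Suc n"])
    show "ind (W n i) \<in> linf G"
      unfolding ind_def by (rule linf_indicator[OF W_carrier])
    fix s assume "ind (W n i) s \<noteq> 0"
    then obtain w where w: "s = word G x w" "w \<in> increasing_lists" "length w = n"
      by (auto simp: ind_def W_def split: if_splits)
    then show "s \<in> f.superlevel {\<one>} (1 / Suc n)"
      using word_closed[of x, OF x] by (simp add: f.superlevel_def f_word)
  qed auto
  have W_0: "W 0 i = {\<one>}" for i
    by (auto simp: W_def increasing_lists_def)
  have W_Suc: "ind (W (Suc n) i) = (\<lambda>s. translate G (x i) (ind (W n (Suc i))) s + ind (W (Suc n) (Suc i)) s)"
    for n i
  proof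
    fix s
    have "s \<in> W (Suc n) i \<longleftrightarrow> (s \<in> carrier G \<and> inv (x i) \<otimes> s \<in> W n (Suc i)) \<or> s \<in> W (Suc n) (Suc i)"
      (is "?l \<longleftrightarrow> ?a \<or> ?b")
    proof
      assume ?l
      then obtain w where w: "s = word G x w" "w \<in> increasing_lists" "length w = Suc n" "\<forall>j\<in>set w. i \<le> j"
        by (auto simp: W_def)
      then obtain j v where v: "w = j # v" by (cases w) auto
      show "?a \<or> ?b"
      proof (cases "j = i")
        case True
        have "inv (x i) \<otimes> s = word G x v"
          using w(1) v True x word_closed[of x, OF x] by (simp add: m_assoc[symmetric])
        then have ?a
          using w v True x word_closed[of x, OF x]
          by (auto simp: W_def increasing_lists_def intro!: imageI simp: Suc_le_eq)
        then show ?thesis ..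
      next
        case False
        then have "\<forall>k\<in>set w. Suc i \<le> k"
          using w v by (fastforce simp: increasing_lists_def)
        then have ?b using w by (auto simp: W_def)
        then show ?thesis ..
      qed
    next
      assume "?a \<or> ?b"
      then show ?l
      proof
        assume a: ?a
        then obtain v where v: "inv (x i) \<otimes> s = word G x v" "v \<in> increasing_lists" "length v = n"
          "\<forall>j\<in>set v. Suc i \<le> j"
          by (auto simp: W_def)
        have "s = word G x (i # v)"
          using a v(1) x word_closed[of x, OF x] by (simp add: inv_solve_left')
        moreover have "i # v \<in> increasing_lists" "\<forall>j\<in>set (i # v). i \<le> j"
          using v by (auto simp: increasing_lists_def Suc_le_eq intro: less_imp_le)
        ultimately show ?l using v(3) unfolding W_def by (intro image_eqI[of _ _ "i # v"]) auto
      next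
        assume ?b
        then show ?l by (auto simp: W_def intro!: imageI)
      qed
    qed
    moreover have "\<not> (?a \<and> ?b)"
    proof
      assume ab: "?a \<and> ?b"
      then obtain v w where v: "inv (x i) \<otimes> s = word G x v" "v \<in> increasing_lists" "\<forall>j\<in>set v. Suc i \<le> j"
        and w: "s = word G x w" "w \<in> increasing_lists" "\<forall>j\<in>set w. Suc i \<le> j"
        by (auto simp: W_def)
      have "s = word G x (i # v)"
        using ab v(1) x word_closed[of x, OF x] by (simp add: inv_solve_left')
      moreover have "i # v \<in> increasing_lists"
        using v by (auto simp: increasing_lists_def Suc_le_eq)
      ultimately have "i # v = w"
        using w(1,2) by (intro inj_onD[OF inj]) simp_all
      then show False using w(3) by auto
    qed
    ultimately show "ind (W (Suc n) i) s = translate G (x i) (ind (W n (Suc i))) s + ind (W (Suc n) (Suc i)) s"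
      by (auto simp: ind_def translate_def)
  qed
  have "\<mu> g = 0" if \<mu>: "invariant_integral G f.linf_cpt \<mu>" and g: "g \<in> f.linf_cpt" for \<mu> g
  proof -
    have pos: "positive_functional f.linf_cpt \<mu>"
      and inv: "\<And>t g. t \<in> carrier G \<Longrightarrow> g \<in> f.linf_cpt \<Longrightarrow> \<mu> (translate G t g) = \<mu> g"
      using \<mu> by (auto simp: invariant_integral_iff)
    have ind_nonneg: "0 \<le> \<mu> (ind (W n i))" for n i
      by (rule positive_functionalD(3)[OF pos ind_W]) (simp add: ind_def less_eq_complex_def)
    have "Re (\<mu> (ind (W n i))) = 0" for n i
    proof (rule shifted_recurrence_zero)
      show "0 \<le> Re (\<mu> (ind (W n i)))" for n i
        using ind_nonneg[of n i] by (simp add: less_eq_complex_def)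
      show "Re (\<mu> (ind (W 0 i))) = Re (\<mu> (ind (W 0 0)))" for i
        by (simp add: W_0)
      show "Re (\<mu> (ind (W (Suc n) i))) = Re (\<mu> (ind (W n (Suc i)))) + Re (\<mu> (ind (W (Suc n) (Suc i))))"
        for n i
        using positive_functionalD(1)[OF pos f.translate_linf_cpt[OF ind_W x] ind_W]
        by (simp add: W_Suc[of n i] inv[OF x ind_W])
    qed
    then have null: "\<mu> (ind (W n i)) = 0" for n i
      using ind_nonneg[of n i] by (simp add: less_eq_complex_def complex_eq_iff)
    obtain F \<epsilon> where F: "finite F" "F \<subseteq> carrier G" "\<epsilon> > 0" "\<And>s. g s \<noteq> 0 \<Longrightarrow> s \<in> f.superlevel F \<epsilon>"
      using f.linf_cptD[OF g] by blast
    have gl: "g \<in> linf G" using g f.linf_cpt_subset by blast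
    obtain B where B: "B > 0" "\<And>s. cmod (g s) \<le> B"
      using linf_bounded[OF gl] by metis
    obtain M :: nat where M: "1 / \<epsilon> \<le> real M"
      using real_arch_simple by blast
    define h where "h p = translate G (fst p) (ind (W (snd p) 0))" for p :: "'a \<times> nat"
    define I where "I = F \<times> {..M}"
    have h: "h p \<in> f.linf_cpt \<and> \<mu> (h p) = 0" if "p \<in> I" for p
      using that F(2) f.translate_linf_cpt[OF ind_W] inv[OF _ ind_W] null by (auto simp: h_def I_def)
    have "finite I" using F(1) by (simp add: I_def)
    then have sum: "(\<lambda>s. \<Sum>p\<in>I. h p s) \<in> f.linf_cpt" "\<mu> (\<lambda>s. \<Sum>p\<in>I. h p s) = 0"
      using positive_functional_sum[OF f.solid_linf_cpt pos, of I h] h by auto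
    show ?thesis
    proof (rule positive_functional_null[OF f.solid_linf_cpt pos gl])
      show "(\<lambda>s. complex_of_real B * (\<Sum>p\<in>I. h p s)) \<in> f.linf_cpt"
        by (rule solid_subspaceD(4)[OF f.solid_linf_cpt sum(1)])
      show "\<mu> (\<lambda>s. complex_of_real B * (\<Sum>p\<in>I. h p s)) = 0"
        using positive_functionalD(2)[OF pos sum(1)] sum(2) by simp
      fix s assume s: "s \<in> carrier G"
      have hr: "h p s = complex_of_real (Re (h p s))" "0 \<le> Re (h p s)" for p
        by (auto simp: h_def ind_def translate_def)
      have sumr: "(\<Sum>p\<in>I. h p s) = complex_of_real (\<Sum>p\<in>I. Re (h p s))"
        unfolding of_real_sum using hr(1) by (rule sum.cong[OF refl])
      have "cmod (g s) \<le> B * (\<Sum>p\<in>I. Re (h p s))"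
      proof (cases "g s = 0")
        case True
        then show ?thesis using B(1) hr(2) by (simp add: sum_nonneg)
      next
        case False
        then obtain t where t: "t \<in> F" "\<epsilon> \<le> Re (f (inv t \<otimes> s))"
          using F(4) by (auto simp: f.superlevel_def)
        then have "f (inv t \<otimes> s) \<noteq> 0" using F(3) by auto
        then obtain w where w: "inv t \<otimes> s = word G x w" "w \<in> increasing_lists"
          using f0 by blast
        have "\<epsilon> * real (Suc (length w)) \<le> 1"
          using t(2) w f_word by (simp add: divide_simps)
        then have "real (Suc (length w)) \<le> 1 / \<epsilon>"
          using F(3) by (simp add: field_simps)
        then have "length w \<le> M" using M by linarith
        then have p: "(t, length w) \<in> I" using t(1) by (simp add: I_def)
        have "Re (h (t, length w) s) = 1"
          using w s by (auto simp: h_def translate_def ind_def W_def)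
        then have "1 \<le> (\<Sum>p\<in>I. Re (h p s))"
          using member_le_sum[OF p, of "\<lambda>p. Re (h p s)"] hr(2) \<open>finite I\<close> by simp
        then have "B * 1 \<le> B * (\<Sum>p\<in>I. Re (h p s))"
          using B(1) by (intro mult_left_mono) auto
        then show ?thesis using B(2)[of s] by linarith
      qed
      then show "complex_of_real (cmod (g s)) \<le> complex_of_real B * (\<Sum>p\<in>I. h p s)"
        unfolding sumr of_real_mult[symmetric] by (simp only: less_eq_complex_def Re_complex_of_real Im_complex_of_real)
    qed
  qed
  moreover have "f \<noteq> (\<lambda>_. 0)"
  proof
    assume "f = (\<lambda>_. 0)"
    then show False using f_word[of "[]"] by (simp add: increasing_lists_def)
  qed
  ultimately show ?thesis
    using f.positive_linf_axioms f.linf_c_eq_linf_cpt by auto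
qed

section \<open>The product topology on spaces of complex functions\<close>

definition complex_functions :: "(real, 'i \<Rightarrow> complex) module" where
  "complex_functions = \<lparr>carrier = UNIV, monoid.mult = (\<lambda>_ _ _. 0), one = (\<lambda>_. 0), zero = (\<lambda>_. 0),
     add = (\<lambda>u v i. u i + v i), smult = (\<lambda>a v i. complex_of_real a * v i)\<rparr>"

lemma complex_functions_simps [simp]:
  "carrier complex_functions = UNIV"
  "\<zero>\<^bsub>complex_functions\<^esub> = (\<lambda>_. 0)"
  "u \<oplus>\<^bsub>complex_functions\<^esub> v = (\<lambda>i. u i + v i)"
  "a \<odot>\<^bsub>complex_functions\<^esub> v = (\<lambda>i. complex_of_real a * v i)"
  by (simp_all add: complex_functions_def)

lemma module_complex_functions: "module real_field_ring (complex_functions :: (real, 'i \<Rightarrow> complex) module)"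
proof (rule moduleI)
  show "cring real_field_ring" by (rule cring_from_type_algebra)
  show "abelian_group (complex_functions :: (real, 'i \<Rightarrow> complex) module)"
  proof (rule abelian_groupI)
    fix v :: "'i \<Rightarrow> complex"
    show "\<exists>u\<in>carrier complex_functions. u \<oplus>\<^bsub>complex_functions\<^esub> v = \<zero>\<^bsub>complex_functions\<^esub>"
      by (auto intro!: exI[of _ "\<lambda>i. - v i"])
  qed (auto simp: add_ac)
qed (auto simp: ring_of_type_algebra_def algebra_simps)

lemma complex_functions_uminus: "\<ominus>\<^bsub>complex_functions\<^esub> v = (\<lambda>i. - v i)"
proof -
  interpret module real_field_ring "complex_functions :: (real, 'a \<Rightarrow> complex) module"
    by (rule module_complex_functions)
  show ?thesis by (rule M.minus_equality) auto
qed

lemma complex_functions_minus: "u \<ominus>\<^bsub>complex_functions\<^esub> v = (\<lambda>i. u i - v i)"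
  by (simp add: a_minus_def complex_functions_uminus)

lemma open_fun_zero_basis:
  fixes U :: "('i \<Rightarrow> complex) set"
  assumes "open U" "(\<lambda>_. 0) \<in> U"
  obtains I \<epsilon> where "finite I" "\<epsilon> > 0" "{v. \<forall>i\<in>I. cmod (v i) < \<epsilon>} \<subseteq> U"
proof -
  have "openin (product_topology (\<lambda>_. euclidean) UNIV) U"
    using assms(1) by (simp add: open_fun_def)
  from product_topology_open_contains_basis[OF this assms(2)] obtain A
    where A: "\<And>i. 0 \<in> A i" "\<And>i. open (A i)" "finite {i. A i \<noteq> UNIV}" "(\<Pi>\<^sub>E i\<in>UNIV. A i) \<subseteq> U"
    by auto
  have "\<exists>e>0. ball 0 e \<subseteq> A i" for i
    using A(1,2) open_contains_ball by blast
  then obtain e where e: "\<And>i. e i > 0" "\<And>i. ball 0 (e i) \<subseteq> A i"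
    by metis
  define I where "I = {i. A i \<noteq> UNIV}"
  define \<epsilon> where "\<epsilon> = Min (insert 1 (e ` I))"
  have fin: "finite I" using A(3) by (simp add: I_def)
  then have "\<epsilon> > 0" using e(1) by (auto simp: \<epsilon>_def)
  moreover have "{v. \<forall>i\<in>I. cmod (v i) < \<epsilon>} \<subseteq> U"
  proof
    fix v assume "v \<in> {v. \<forall>i\<in>I. cmod (v i) < \<epsilon>}"
    then have v: "\<And>i. i \<in> I \<Longrightarrow> cmod (v i) < \<epsilon>" by simp
    have "v i \<in> A i" for i
    proof (cases "i \<in> I")
      case True
      then have "\<epsilon> \<le> e i" using fin by (auto simp: \<epsilon>_def)
      then have "v i \<in> ball 0 (e i)" using v[OF True] by simp
      then show ?thesis using e(2) by blast
    next
      case False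
      then show ?thesis by (simp add: I_def)
    qed
    then show "v \<in> U" using A(4) by (auto simp: PiE_def)
  qed
  ultimately show ?thesis using that fin by blast
qed

lemma hausdorff_lctvs_complex_functions:
  "hausdorff_lctvs (complex_functions :: (real, 'i \<Rightarrow> complex) module) euclidean"
  unfolding hausdorff_lctvs_def
proof (intro conjI allI impI)
  show "module real_field_ring (complex_functions :: (real, 'i \<Rightarrow> complex) module)"
    by (rule module_complex_functions)
  show "Hausdorff_space (euclidean :: ('i \<Rightarrow> complex) topology)"
    unfolding euclidean_product_topology[symmetric] Hausdorff_space_product_topology by simp
  have coord: "continuous_on UNIV (\<lambda>p :: 'c :: topological_space \<times> ('i \<Rightarrow> complex). snd p i)" for i
    by (intro continuous_on_product_then_coordinatewise[of UNIV snd] continuous_intros)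
  have coord': "continuous_on UNIV (\<lambda>p :: ('i \<Rightarrow> complex) \<times> ('i \<Rightarrow> complex). fst p i)" for i
    by (intro continuous_on_product_then_coordinatewise[of UNIV fst] continuous_intros)
  show "continuous_map (prod_topology euclidean euclidean) euclidean
      (\<lambda>(x, y). x \<oplus>\<^bsub>complex_functions\<^esub> (y :: 'i \<Rightarrow> complex))"
    by (simp add: case_prod_unfold) (intro continuous_on_coordinatewise_then_product continuous_on_add coord coord')
  show "continuous_map (prod_topology euclideanreal euclidean) euclidean
      (\<lambda>(a, x). a \<odot>\<^bsub>complex_functions\<^esub> (x :: 'i \<Rightarrow> complex))"
    by (simp add: case_prod_unfold) (intro continuous_on_coordinatewise_then_product continuous_intros coord)
next
  fix U :: "('i \<Rightarrow> complex) set"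
  assume "openin euclidean U \<and> \<zero>\<^bsub>complex_functions\<^esub> \<in> U"
  then have U: "open U" "(\<lambda>_. 0) \<in> U" by auto
  obtain I \<epsilon> where I: "finite I" "\<epsilon> > 0" "{v. \<forall>i\<in>I. cmod (v i) < \<epsilon>} \<subseteq> U"
    using open_fun_zero_basis[OF U] .
  define W where "W = {v :: 'i \<Rightarrow> complex. \<forall>i\<in>I. v i \<in> ball 0 \<epsilon>}"
  have "open W"
    unfolding W_def by (rule product_topology_basis'[OF I(1), of "\<lambda>_. ball 0 \<epsilon>" "\<lambda>i. i"]) simp
  moreover have "convex_in complex_functions W"
    unfolding convex_in_def
  proof (intro ballI allI impI)
    fix u v :: "'i \<Rightarrow> complex" and a :: real
    assume uv: "u \<in> W" "v \<in> W" and a: "0 \<le> a \<and> a \<le> 1"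
    have "a *\<^sub>R u i + (1 - a) *\<^sub>R v i \<in> ball 0 \<epsilon>" if "i \<in> I" for i
      using uv a that by (intro convexD[OF convex_ball]) (auto simp: W_def)
    then show "(a \<odot>\<^bsub>complex_functions\<^esub> u) \<oplus>\<^bsub>complex_functions\<^esub> ((1 - a) \<odot>\<^bsub>complex_functions\<^esub> v) \<in> W"
      by (simp add: W_def scaleR_conv_of_real)
  qed
  ultimately show "\<exists>W. openin euclidean W \<and> \<zero>\<^bsub>complex_functions\<^esub> \<in> W \<and> W \<subseteq> U \<and> convex_in complex_functions W"
    using I by (intro exI[of _ W]) (auto simp: W_def)
qed auto

lemma dual_space_complex_functions:
  "\<psi> \<in> dual_space complex_functions euclidean \<longleftrightarrow> continuous_on UNIV \<psi> \<and>
     (\<forall>u v. \<psi> (\<lambda>i. u i + v i) = \<psi> u + \<psi> v) \<and> (\<forall>a v. \<psi> (\<lambda>i. complex_of_real a * v i) = a * \<psi> v)"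
  by (simp add: dual_space_def)

lemma coordinate_dual_space:
  "(\<lambda>v. Re (v i)) \<in> dual_space complex_functions euclidean"
  "(\<lambda>v. Im (v i)) \<in> dual_space complex_functions euclidean"
proof -
  have "continuous_on UNIV (\<lambda>v :: 'a \<Rightarrow> complex. v i)"
    by (rule continuous_on_product_then_coordinatewise[OF continuous_on_id])
  then show "(\<lambda>v. Re (v i)) \<in> dual_space complex_functions euclidean"
    "(\<lambda>v. Im (v i)) \<in> dual_space complex_functions euclidean"
    unfolding dual_space_complex_functions by (simp_all add: continuous_on_Re continuous_on_Im)
qed

lemma dual_space_finite_support:
  assumes "\<psi> \<in> dual_space (complex_functions :: (real, 'i \<Rightarrow> complex) module) euclidean"
  obtains I where "finite I" "\<And>v. (\<And>i. i \<in> I \<Longrightarrow> v i = 0) \<Longrightarrow> \<psi> v = 0"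
proof -
  have cont: "continuous_on UNIV \<psi>" and scale: "\<And>a v. \<psi> (\<lambda>i. complex_of_real a * v i) = a * \<psi> v"
    using assms by (auto simp: dual_space_complex_functions)
  have "\<psi> (\<lambda>_. 0) = 0"
    using scale[of 0 "\<lambda>_. 0"] by simp
  moreover have "open (\<psi> -` {-1<..<1})"
    using cont by (intro open_vimage) auto
  ultimately have "open (\<psi> -` {-1<..<1})" "(\<lambda>_. 0) \<in> \<psi> -` {-1<..<1}"
    by auto
  then obtain I \<epsilon> where I: "finite I" "\<epsilon> > 0" "{v. \<forall>i\<in>I. cmod (v i) < \<epsilon>} \<subseteq> \<psi> -` {-1<..<1}"
    by (rule open_fun_zero_basis)
  have "\<psi> v = 0" if "\<And>i. i \<in> I \<Longrightarrow> v i = 0" for v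
  proof (rule ccontr)
    assume "\<psi> v \<noteq> 0"
    moreover have "(\<lambda>i. complex_of_real (1 / \<psi> v) * v i) \<in> \<psi> -` {-1<..<1}"
      using that I(2) by (intro subsetD[OF I(3)]) simp
    ultimately show False
      by (simp only: vimage_eq scale) simp
  qed
  then show ?thesis using that I(1) by blast
qed

lemma openin_weak_topology_open:
  assumes "openin (weak_topology complex_functions euclidean) U"
  shows "open U"
proof -
  have "generate_topology_on {{x \<in> carrier complex_functions. \<phi> x \<in> U} |\<phi> U.
      \<phi> \<in> dual_space complex_functions euclidean \<and> open U} U"
    using assms by (simp only: weak_topology_def openin_topology_generated_by_iff)
  then show ?thesis
  proof induction
    case (Basis S)
    then obtain \<phi> V where "S = {x \<in> carrier complex_functions. \<phi> x \<in> V}"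
      "\<phi> \<in> dual_space complex_functions euclidean" "open V"
      by blast
    then have "S = \<phi> -` V" "continuous_on UNIV \<phi>" "open V"
      by (auto simp: dual_space_complex_functions)
    then show ?case using open_vimage by blast
  qed auto
qed

lemma openin_weak_topology_preimage:
  assumes "\<phi> \<in> dual_space complex_functions euclidean" "open S"
  shows "openin (weak_topology complex_functions euclidean) {v. \<phi> v \<in> S}"
proof -
  have "{v. \<phi> v \<in> S} = {v \<in> carrier complex_functions. \<phi> v \<in> S}"
    by simp
  then show ?thesis
    unfolding weak_topology_def using assms by (intro topology_generated_by_Basis CollectI exI conjI)
qed

lemma openin_weak_topology_coordinate:
  "openin (weak_topology complex_functions euclidean) {v. \<bar>Re (v i)\<bar> < \<epsilon> \<and> \<bar>Im (v i)\<bar> < \<epsilon>}"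
proof -
  have "{v. \<bar>Re (v i)\<bar> < \<epsilon> \<and> \<bar>Im (v i)\<bar> < \<epsilon>}
      = {v. Re (v i) \<in> {-\<epsilon><..<\<epsilon>}} \<inter> {v. Im (v i) \<in> {-\<epsilon><..<\<epsilon>}}"
    by (simp add: set_eq_iff abs_less_iff) linarith
  then show ?thesis
    using openin_Int[OF openin_weak_topology_preimage[OF coordinate_dual_space(1)[of i], of "{-\<epsilon><..<\<epsilon>}"]
        openin_weak_topology_preimage[OF coordinate_dual_space(2)[of i], of "{-\<epsilon><..<\<epsilon>}"]]
    by (simp only: open_greaterThanLessThan)
qed

lemma weakly_Cauchy_converges:
  fixes F :: "('i \<Rightarrow> complex) filter"
  assumes "F \<noteq> bot"
    and Cauchy: "\<And>U. openin (weak_topology complex_functions euclidean) U \<Longrightarrow> (\<lambda>_. 0) \<in> U \<Longrightarrow>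
      \<forall>\<^sub>F (x, y) in F \<times>\<^sub>F F. (\<lambda>i. x i - y i) \<in> U"
  obtains c where "\<And>i. ((\<lambda>x. x i) \<longlongrightarrow> c i) F"
    "limitin (weak_topology complex_functions euclidean) (\<lambda>x. x) c F"
proof -
  have "\<exists>l. ((\<lambda>x. x i) \<longlongrightarrow> l) F" for i
  proof -
    have "cauchy_filter (filtermap (\<lambda>x. x i) F)"
      unfolding cauchy_filter_def le_filter_def
    proof (intro allI impI)
      fix P :: "complex \<times> complex \<Rightarrow> bool"
      assume "eventually P uniformity"
      then obtain e where e: "e > 0" "\<And>x y. dist x y < e \<Longrightarrow> P (x, y)"
        unfolding eventually_uniformity_metric by blast
      have "\<forall>\<^sub>F (x, y) in F \<times>\<^sub>F F. (\<lambda>i. x i - y i) \<in> {v. \<bar>Re (v i)\<bar> < e / 2 \<and> \<bar>Im (v i)\<bar> < e / 2}"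
        using e(1) by (intro Cauchy openin_weak_topology_coordinate) auto
      then have "\<forall>\<^sub>F p in F \<times>\<^sub>F F. P (fst p i, snd p i)"
      proof (rule eventually_mono)
        fix p :: "('i \<Rightarrow> complex) \<times> ('i \<Rightarrow> complex)"
        assume "case p of (x, y) \<Rightarrow> (\<lambda>i. x i - y i) \<in> {v. \<bar>Re (v i)\<bar> < e / 2 \<and> \<bar>Im (v i)\<bar> < e / 2}"
        then have "cmod (fst p i - snd p i) < e"
          using cmod_le[of "fst p i - snd p i"] by (auto simp: case_prod_unfold)
        then show "P (fst p i, snd p i)"
          by (intro e(2)) (simp add: dist_norm)
      qed
      then show "eventually P (filtermap (\<lambda>x. x i) F \<times>\<^sub>F filtermap (\<lambda>x. x i) F)"
        by (simp add: prod_filtermap1 prod_filtermap2 eventually_filtermap apfst_def apsnd_def map_prod_def case_prod_unfold)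
    qed
    then have "\<exists>l. filtermap (\<lambda>x. x i) F \<le> nhds l"
      using assms(1) by (intro cauchy_filter_complete_converges[of _ UNIV])
        (auto simp: complete_UNIV filtermap_bot_iff)
    then show ?thesis by (simp add: filterlim_def)
  qed
  then obtain c where c: "\<And>i. ((\<lambda>x. x i) \<longlongrightarrow> c i) F" by metis
  have "limitin (product_topology (\<lambda>_. euclidean) UNIV) (\<lambda>x. x) c F"
    using c by (simp add: limitin_componentwise)
  then have lim: "limitin euclidean (\<lambda>x. x) c F"
    by (simp only: euclidean_product_topology)
  have "openin (weak_topology complex_functions euclidean) (UNIV :: ('i \<Rightarrow> complex) set)"
    using openin_weak_topology_preimage[OF coordinate_dual_space(1) open_UNIV] by simp
  then have "c \<in> topspace (weak_topology complex_functions euclidean)"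
    using openin_subset by blast
  then have "limitin (weak_topology complex_functions euclidean) (\<lambda>x. x) c F"
    using lim openin_weak_topology_open by (auto simp: limitin_def)
  with c show ?thesis using that by blast
qed

section \<open>The cone of positive functionals\<close>

context positive_linf
begin

definition dom_cone :: "(('a \<Rightarrow> complex) \<Rightarrow> complex) set" where
  "dom_cone = {\<mu>. (\<forall>g. g \<notin> linf_dom G f \<longrightarrow> \<mu> g = 0) \<and> positive_functional (linf_dom G f) \<mu>}"

text \<open>The action is trivial in the coordinates outside \<open>linf_dom G f\<close>, since \<open>translate G \<one>\<close> is not the
  identity on functions that do not vanish outside \<open>carrier G\<close>.\<close>

definition dom_action :: "'a \<Rightarrow> (('a \<Rightarrow> complex) \<Rightarrow> complex) \<Rightarrow> ('a \<Rightarrow> complex) \<Rightarrow> complex" where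
  "dom_action t v = (\<lambda>g. if g \<in> linf_dom G f then v (translate G (inv t) g) else v g)"

lemma dom_coneD:
  assumes "\<mu> \<in> dom_cone"
  shows "\<And>g. g \<notin> linf_dom G f \<Longrightarrow> \<mu> g = 0" "positive_functional (linf_dom G f) \<mu>"
  using assms by (auto simp: dom_cone_def)

lemma dom_action_one: "dom_action \<one> v = v"
proof
  fix g
  have "g \<in> linf_dom G f \<Longrightarrow> translate G \<one> g = g"
    using linf_dom_subset by (intro translate_one) blast
  then show "dom_action \<one> v g = v g"
    by (simp add: dom_action_def)
qed

lemma dom_action_mult:
  assumes "t \<in> carrier G" "u \<in> carrier G"
  shows "dom_action t (dom_action u v) = dom_action (t \<otimes> u) v"
  using assms by (simp add: dom_action_def fun_eq_iff translate_linf_dom translate_mult inv_mult_group)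

lemma bij_dom_action:
  assumes "t \<in> carrier G"
  shows "bij (dom_action t)"
proof (rule o_bij)
  show "dom_action (inv t) \<circ> dom_action t = id" "dom_action t \<circ> dom_action (inv t) = id"
    using assms by (simp_all add: fun_eq_iff dom_action_mult dom_action_one)
qed

lemma continuous_linear_dom_action:
  "continuous_linear_action G complex_functions euclidean dom_action"
  unfolding continuous_linear_action_def
proof (intro conjI ballI allI)
  have "dom_action \<in> hom G (BijGroup UNIV)"
  proof (rule homI)
    fix t u assume t: "t \<in> carrier G" "u \<in> carrier G"
    then show "dom_action (t \<otimes> u) = dom_action t \<otimes>\<^bsub>BijGroup UNIV\<^esub> dom_action u"
      by (simp add: BijGroup_def Bij_def extensional_def bij_dom_action compose_def restrict_def fun_eq_iff
          dom_action_mult)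
  qed (simp add: BijGroup_def Bij_def extensional_def bij_dom_action)
  then show "group_action G (carrier complex_functions) dom_action"
    by (simp add: group_action_def group_hom_def group_hom_axioms_def group_BijGroup is_group)
  show "continuous_map euclidean euclidean (dom_action t)" for t
  proof -
    have "continuous_on UNIV (\<lambda>v. dom_action t v g)" for g
      unfolding dom_action_def
      by (cases "g \<in> linf_dom G f") (simp_all add: continuous_on_product_then_coordinatewise[OF continuous_on_id])
    then show ?thesis
      by (simp add: continuous_on_coordinatewise_then_product)
  qed
qed (auto simp: dom_action_def)

lemma dom_action_cone:
  assumes "t \<in> carrier G" "\<mu> \<in> dom_cone"
  shows "dom_action t \<mu> \<in> dom_cone"
proof -
  note D = solid_subspaceD[OF solid_linf_dom] and \<mu> = positive_functionalD[OF dom_coneD(2)[OF assms(2)]]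
  have tr: "translate G (inv t) g \<in> linf_dom G f" if "g \<in> linf_dom G f" for g
    using translate_linf_dom[OF that] assms(1) by simp
  have "positive_functional (linf_dom G f) (dom_action t \<mu>)"
    unfolding positive_functional_def
  proof (intro conjI ballI allI impI)
    fix g h assume "g \<in> linf_dom G f" "h \<in> linf_dom G f"
    then show "dom_action t \<mu> (\<lambda>s. g s + h s) = dom_action t \<mu> g + dom_action t \<mu> h"
      by (simp add: dom_action_def D tr translate_add \<mu>)
  next
    fix c g assume "g \<in> linf_dom G f"
    then show "dom_action t \<mu> (\<lambda>s. c * g s) = c * dom_action t \<mu> g"
      by (simp add: dom_action_def D tr translate_scale \<mu>)
  next
    fix g assume "g \<in> linf_dom G f" "\<forall>s. 0 \<le> g s"
    then show "0 \<le> dom_action t \<mu> g"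
      using \<mu>(3)[OF tr translate_nonneg] by (simp add: dom_action_def)
  qed
  then show ?thesis
    using dom_coneD(1)[OF assms(2)] by (simp add: dom_cone_def dom_action_def)
qed

lemma cone_in_dom_cone: "cone_in complex_functions dom_cone"
  unfolding cone_in_def
proof (intro conjI ballI allI impI)
  have "(\<lambda>_. 0) \<in> dom_cone"
    by (simp add: dom_cone_def positive_functional_def)
  then show "dom_cone \<noteq> {}" by blast
  fix \<mu> \<nu> assume "\<mu> \<in> dom_cone" "\<nu> \<in> dom_cone"
  then show "\<mu> \<oplus>\<^bsub>complex_functions\<^esub> \<nu> \<in> dom_cone"
    by (auto simp: dom_cone_def positive_functional_def algebra_simps intro: add_nonneg_nonneg)
next
  fix a :: real and \<mu> assume a: "a \<ge> 0" and \<mu>: "\<mu> \<in> dom_cone"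
  have "0 \<le> complex_of_real a"
    using a by (simp add: less_eq_complex_def)
  then show "a \<odot>\<^bsub>complex_functions\<^esub> \<mu> \<in> dom_cone"
    using \<mu> by (simp add: dom_cone_def positive_functional_def distrib_left mult.left_commute)
qed simp

lemma cmod_linf_dom:
  assumes "g \<in> linf_dom G f"
  shows "(\<lambda>s. complex_of_real (cmod (g s))) \<in> linf_dom G f"
proof (rule solid_subspaceD(5)[OF solid_linf_dom assms])
  have g: "g \<in> linf G" using assms linf_dom_subset by blast
  obtain B where "\<And>s. cmod (g s) \<le> B"
    using linf_bounded[OF g] by metis
  then show "(\<lambda>s. complex_of_real (cmod (g s))) \<in> linf G"
    by (intro linfI[where B = B]) (auto simp: linf_zero_outside[OF g])
qed simp

lemma proper_dom_cone: "proper_cone complex_functions dom_cone"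
  unfolding proper_cone_def
proof
  show "dom_cone \<inter> (\<lambda>x. \<ominus>\<^bsub>complex_functions\<^esub> x) ` dom_cone \<subseteq> {\<zero>\<^bsub>complex_functions\<^esub>}"
  proof
    fix \<mu> assume "\<mu> \<in> dom_cone \<inter> (\<lambda>x. \<ominus>\<^bsub>complex_functions\<^esub> x) ` dom_cone"
    then obtain \<nu> where \<mu>: "\<mu> \<in> dom_cone" and "\<nu> \<in> dom_cone" "\<mu> = \<ominus>\<^bsub>complex_functions\<^esub> \<nu>"
      by blast
    then have \<nu>: "\<nu> \<in> dom_cone" "\<mu> = (\<lambda>g. - \<nu> g)"
      by (simp_all add: complex_functions_uminus)
    have "\<mu> g = 0" for g
    proof (cases "g \<in> linf_dom G f")
      case True
      let ?u = "\<lambda>s. complex_of_real (cmod (g s))"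
      have "0 \<le> \<mu> ?u" "0 \<le> \<nu> ?u"
        using positive_functionalD(3)[OF dom_coneD(2) cmod_linf_dom[OF True]] \<mu> \<nu>(1)
        by (simp_all add: less_eq_complex_def)
      then have "\<mu> ?u = 0"
        using \<nu>(2) by (simp add: less_eq_complex_def complex_eq_iff)
      then show ?thesis
        using positive_functional_null[OF solid_linf_dom dom_coneD(2)[OF \<mu>] _ cmod_linf_dom[OF True]]
          True linf_dom_subset by blast
    next
      case False
      then show ?thesis by (rule dom_coneD(1)[OF \<mu>])
    qed
    then show "\<mu> \<in> {\<zero>\<^bsub>complex_functions\<^esub>}" by (simp add: fun_eq_iff)
  qed
  have "(\<lambda>_. 0) \<in> dom_cone"
    by (simp add: dom_cone_def positive_functional_def)
  then show "{\<zero>\<^bsub>complex_functions\<^esub>} \<subseteq> dom_cone \<inter> (\<lambda>x. \<ominus>\<^bsub>complex_functions\<^esub> x) ` dom_cone"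
    by (auto simp: complex_functions_uminus intro!: image_eqI[of _ _ "\<lambda>_. 0"])
qed

lemma weakly_complete_dom_cone: "weakly_complete complex_functions euclidean dom_cone"
  unfolding weakly_complete_def
proof (intro allI impI)
  fix F :: "(('a \<Rightarrow> complex) \<Rightarrow> complex) filter"
  assume F: "F \<noteq> bot \<and> (\<forall>\<^sub>F x in F. x \<in> dom_cone) \<and>
    (\<forall>U. openin (weak_topology complex_functions euclidean) U \<and> \<zero>\<^bsub>complex_functions\<^esub> \<in> U \<longrightarrow>
      (\<forall>\<^sub>F (x, y) in F \<times>\<^sub>F F. x \<ominus>\<^bsub>complex_functions\<^esub> y \<in> U))"
  then have nontriv: "F \<noteq> bot" and ev: "\<forall>\<^sub>F x in F. x \<in> dom_cone"
    and Cauchy: "\<And>U. openin (weak_topology complex_functions euclidean) U \<Longrightarrow> (\<lambda>_. 0) \<in> U \<Longrightarrow>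
      \<forall>\<^sub>F (x, y) in F \<times>\<^sub>F F. (\<lambda>i. x i - y i) \<in> U"
    by (simp_all add: complex_functions_minus)
  obtain c where c: "\<And>g. ((\<lambda>x. x g) \<longlongrightarrow> c g) F"
    and lim: "limitin (weak_topology complex_functions euclidean) (\<lambda>x. x) c F"
    using weakly_Cauchy_converges[OF nontriv Cauchy] by metis
  note unique = tendsto_unique[OF nontriv]
  have "positive_functional (linf_dom G f) c"
    unfolding positive_functional_def
  proof (intro conjI ballI allI impI)
    fix g h assume gh: "g \<in> linf_dom G f" "h \<in> linf_dom G f"
    have "\<forall>\<^sub>F x in F. x g + x h = x (\<lambda>s. g s + h s)"
      using ev by eventually_elim (use gh in \<open>simp add: dom_cone_def positive_functional_def\<close>)
    then have "((\<lambda>x. x (\<lambda>s. g s + h s)) \<longlongrightarrow> c g + c h) F"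
      by (rule Lim_transform_eventually[OF tendsto_add[OF c c]])
    then show "c (\<lambda>s. g s + h s) = c g + c h"
      by (rule unique[OF c])
  next
    fix a g assume g: "g \<in> linf_dom G f"
    have "\<forall>\<^sub>F x in F. a * x g = x (\<lambda>s. a * g s)"
      using ev by eventually_elim (use g in \<open>simp add: dom_cone_def positive_functional_def\<close>)
    then have "((\<lambda>x. x (\<lambda>s. a * g s)) \<longlongrightarrow> a * c g) F"
      by (rule Lim_transform_eventually[OF tendsto_mult_left[OF c]])
    then show "c (\<lambda>s. a * g s) = a * c g"
      by (rule unique[OF c])
  next
    fix g assume g: "g \<in> linf_dom G f" "\<forall>s. 0 \<le> g s"
    have pos: "\<forall>\<^sub>F x in F. 0 \<le> x g"
      using ev by eventually_elim (use g in \<open>simp add: dom_cone_def positive_functional_def\<close>)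
    have "\<forall>\<^sub>F x in F. 0 \<le> Re (x g)"
      using pos by eventually_elim (simp add: less_eq_complex_def)
    then have "0 \<le> Re (c g)"
      by (rule tendsto_lowerbound[OF tendsto_Re[OF c] _ nontriv])
    moreover have "\<forall>\<^sub>F x in F. 0 = Im (x g)"
      using pos by eventually_elim (simp add: less_eq_complex_def)
    then have "((\<lambda>x. Im (x g)) \<longlongrightarrow> 0) F"
      by (rule Lim_transform_eventually[OF tendsto_const])
    then have "Im (c g) = 0"
      by (rule unique[OF tendsto_Im[OF c]])
    ultimately show "0 \<le> c g"
      by (simp add: less_eq_complex_def)
  qed
  moreover have "c g = 0" if "g \<notin> linf_dom G f" for g
  proof -
    have "\<forall>\<^sub>F x in F. 0 = x g"
      using ev by eventually_elim (use that in \<open>simp add: dom_cone_def\<close>)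
    then have "((\<lambda>x. x g) \<longlongrightarrow> 0) F"
      by (rule Lim_transform_eventually[OF tendsto_const])
    then show ?thesis by (rule unique[OF c])
  qed
  ultimately have "c \<in> dom_cone" by (simp add: dom_cone_def)
  with lim show "\<exists>c\<in>dom_cone. limitin (weak_topology complex_functions euclidean) (\<lambda>x. x) c F"
    by blast
qed

lemma dual_space_on_dom_cone:
  assumes "\<psi> \<in> dual_space complex_functions euclidean"
  shows "\<exists>h\<in>linf_dom G f. \<forall>\<mu>\<in>dom_cone. \<psi> \<mu> = Re (\<mu> h)"
proof -
  have add: "\<And>u v. \<psi> (\<lambda>i. u i + v i) = \<psi> u + \<psi> v"
    and scale: "\<And>a v. \<psi> (\<lambda>i. complex_of_real a * v i) = a * \<psi> v"
    using assms by (auto simp: dual_space_complex_functions)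
  note D = solid_subspaceD[OF solid_linf_dom]
  obtain I where I: "finite I" "\<And>v. (\<And>i. i \<in> I \<Longrightarrow> v i = 0) \<Longrightarrow> \<psi> v = 0"
    using dual_space_finite_support[OF assms] by metis
  have "\<exists>h\<in>linf_dom G f. \<forall>\<mu>\<in>dom_cone. \<psi> (\<lambda>i. if i \<in> I then \<mu> i else 0) = Re (\<mu> h)"
    using I(1)
  proof (induction I rule: finite_induct)
    case empty
    have "\<psi> (\<lambda>_. 0) = 0"
      using scale[of 0 "\<lambda>_. 0"] by simp
    then have "\<psi> (\<lambda>i. if i \<in> {} then \<mu> i else 0) = Re (\<mu> (\<lambda>_. 0))" if "\<mu> \<in> dom_cone" for \<mu>
      using positive_functional_zero[OF dom_coneD(2)[OF that] D(2)] by simp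
    then show ?case
      using D(2) by blast
  next
    case (insert j I)
    then obtain h where h: "h \<in> linf_dom G f"
      "\<And>\<mu>. \<mu> \<in> dom_cone \<Longrightarrow> \<psi> (\<lambda>i. if i \<in> I then \<mu> i else 0) = Re (\<mu> h)"
      by blast
    define e :: "('a \<Rightarrow> complex) \<Rightarrow> complex" where "e = (\<lambda>i. of_bool (i = j))"
    define e' :: "('a \<Rightarrow> complex) \<Rightarrow> complex" where "e' = (\<lambda>i. \<i> * of_bool (i = j))"
    have split: "\<psi> (\<lambda>i. if i \<in> insert j I then \<mu> i else 0)
      = \<psi> (\<lambda>i. if i \<in> I then \<mu> i else 0) + (Re (\<mu> j) * \<psi> e + Im (\<mu> j) * \<psi> e')" for \<mu>
    proof -
      have "(\<lambda>i. if i \<in> insert j I then \<mu> i else 0) = (\<lambda>i. (if i \<in> I then \<mu> i else 0)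
          + (complex_of_real (Re (\<mu> j)) * e i + complex_of_real (Im (\<mu> j)) * e' i))"
      proof
        fix i
        show "(if i \<in> insert j I then \<mu> i else 0) = (if i \<in> I then \<mu> i else 0)
            + (complex_of_real (Re (\<mu> j)) * e i + complex_of_real (Im (\<mu> j)) * e' i)"
        proof (cases "i = j")
          case True
          then show ?thesis
            using insert.hyps(2) complex_eq[of "\<mu> j"] by (simp add: e_def e'_def mult.commute)
        qed (simp add: e_def e'_def)
      qed
      then show ?thesis by (simp only: add scale)
    qed
    show ?case
    proof (cases "j \<in> linf_dom G f")
      case True
      let ?c = "Complex (\<psi> e) (- \<psi> e')"
      have "\<psi> (\<lambda>i. if i \<in> insert j I then \<mu> i else 0) = Re (\<mu> (\<lambda>s. h s + ?c * j s))"
        if "\<mu> \<in> dom_cone" for \<mu>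
        using positive_functionalD(1)[OF dom_coneD(2)[OF that] h(1) D(4)[OF True, of ?c]]
          positive_functionalD(2)[OF dom_coneD(2)[OF that] True, of ?c]
        unfolding split h(2)[OF that] by (simp add: mult.commute)
      then show ?thesis
        using D(3)[OF h(1) D(4)[OF True, of ?c]] by blast
    next
      case False
      then have "\<psi> (\<lambda>i. if i \<in> insert j I then \<mu> i else 0) = Re (\<mu> h)" if "\<mu> \<in> dom_cone" for \<mu>
        unfolding split h(2)[OF that] using dom_coneD(1)[OF that False] by simp
      then show ?thesis using h(1) by blast
    qed
  qed
  moreover have "\<psi> \<mu> = \<psi> (\<lambda>i. if i \<in> I then \<mu> i else 0)" for \<mu>
  proof -
    have "\<psi> (\<lambda>i. if i \<in> I then 0 else \<mu> i) = 0"
      by (rule I(2)) simp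
    moreover have "\<mu> = (\<lambda>i. (if i \<in> I then \<mu> i else 0) + (if i \<in> I then 0 else \<mu> i))"
      by auto
    ultimately show ?thesis
      using add[of "\<lambda>i. if i \<in> I then \<mu> i else 0" "\<lambda>i. if i \<in> I then 0 else \<mu> i"] by simp
  qed
  ultimately show ?thesis by simp
qed

lemma cobounded_dom_cone:
  "cobounded_type G complex_functions euclidean dom_cone dom_action"
  unfolding cobounded_type_def
proof (intro bexI[of _ "\<lambda>v. Re (v f)"] conjI ballI)
  show "(\<lambda>v. Re (v f)) \<in> dual_space complex_functions euclidean"
    by (rule coordinate_dual_space)
  show "0 \<le> Re (\<mu> f)" if "\<mu> \<in> dom_cone" for \<mu>
    using positive_functionalD(3)[OF dom_coneD(2)[OF that] f_linf_dom f_nonneg]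
    by (simp add: less_eq_complex_def)
  fix \<psi> :: "(('a \<Rightarrow> complex) \<Rightarrow> complex) \<Rightarrow> real"
  assume "\<psi> \<in> dual_space complex_functions euclidean"
  then obtain h where h: "h \<in> linf_dom G f" "\<And>\<mu>. \<mu> \<in> dom_cone \<Longrightarrow> \<psi> \<mu> = Re (\<mu> h)"
    using dual_space_on_dom_cone by blast
  then obtain n and t :: "nat \<Rightarrow> 'a" where n: "n \<ge> 1" and t: "\<And>j. j \<in> {1..n} \<Longrightarrow> t j \<in> carrier G"
    and le: "\<And>s. s \<in> carrier G \<Longrightarrow> complex_of_real (cmod (h s)) \<le> (\<Sum>j=1..n. translate G (t j) f s)"
    unfolding linf_dom_def by blast
  have "\<psi> \<mu> \<le> (\<Sum>j=1..n. Re (dom_action (inv (t j)) \<mu> f))" if \<mu>: "\<mu> \<in> dom_cone" for \<mu>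
  proof -
    note sum = positive_functional_sum[OF solid_linf_dom dom_coneD(2)[OF \<mu>], of "{1..n}"
        "\<lambda>j. translate G (t j) f", OF finite_atLeastAtMost translate_f_linf_dom[OF t]]
    have "\<psi> \<mu> \<le> Re (\<mu> (\<lambda>s. \<Sum>j=1..n. translate G (t j) f s))"
      unfolding h(2)[OF \<mu>]
      by (rule positive_functional_mono[OF solid_linf_dom dom_coneD(2)[OF \<mu>] _ _ le])
        (use h(1) linf_dom_subset sum in auto)
    also have "\<dots> = (\<Sum>j=1..n. Re (\<mu> (translate G (t j) f)))"
      using sum by simp
    also have "\<dots> = (\<Sum>j=1..n. Re (dom_action (inv (t j)) \<mu> f))"
      using t f_linf_dom by (intro sum.cong refl) (simp add: dom_action_def)
    finally show ?thesis .
  qed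
  then show "\<exists>n\<ge>1. \<exists>t :: nat \<Rightarrow> 'a. (\<forall>j\<in>{1..n}. t j \<in> carrier G) \<and>
      (\<forall>\<mu>\<in>dom_cone. \<psi> \<mu> \<le> (\<Sum>j=1..n. Re (dom_action (inv (t j)) \<mu> f)))"
    using n t by (intro exI[of _ n] exI[of _ t]) blast
qed

text \<open>An orbit of evaluation functionals is bounded because every function in \<open>linf_dom G f\<close> is.\<close>

lemma locally_bounded_dom_cone:
  assumes "f \<noteq> (\<lambda>_. 0)"
  shows "locally_bounded_action G complex_functions euclidean dom_cone dom_action"
proof -
  obtain p where "f p \<noteq> 0" using assms by auto
  then have p: "p \<in> carrier G" using linf_zero_outside[OF f_linf] by blast
  define \<delta> :: "('a \<Rightarrow> complex) \<Rightarrow> complex" where "\<delta> g = (if g \<in> linf_dom G f then g p else 0)" for g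
  have "\<delta> \<in> dom_cone"
    using solid_subspaceD(3,4)[OF solid_linf_dom]
    by (simp add: dom_cone_def positive_functional_def \<delta>_def)
  moreover have "\<delta> f \<noteq> 0"
    using \<open>f p \<noteq> 0\<close> f_linf_dom by (simp add: \<delta>_def)
  then have "\<delta> \<noteq> \<zero>\<^bsub>complex_functions\<^esub>"
    by auto
  moreover have "bounded_in complex_functions euclidean (orbit G dom_action \<delta>)"
    unfolding bounded_in_def
  proof (intro allI impI)
    fix U :: "(('a \<Rightarrow> complex) \<Rightarrow> complex) set"
    assume "openin euclidean U \<and> \<zero>\<^bsub>complex_functions\<^esub> \<in> U"
    then have U: "open U" "(\<lambda>_. 0) \<in> U" by auto
    obtain I \<epsilon> where I: "finite I" "\<epsilon> > 0" "{v. \<forall>i\<in>I. cmod (v i) < \<epsilon>} \<subseteq> U"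
      using open_fun_zero_basis[OF U] .
    have "\<exists>B. \<forall>t\<in>carrier G. cmod (dom_action t \<delta> g) \<le> B" for g
    proof (cases "g \<in> linf_dom G f")
      case True
      then obtain B where "\<And>s. cmod (g s) \<le> B"
        using linf_bounded[of g G] linf_dom_subset by blast
      then show ?thesis
        using True translate_linf_dom[OF True]
        by (intro exI[of _ B] ballI) (simp add: dom_action_def \<delta>_def, simp add: translate_def p)
    next
      case False
      then show ?thesis by (intro exI[of _ 0]) (simp add: dom_action_def \<delta>_def)
    qed
    then obtain B where B: "\<And>g t. t \<in> carrier G \<Longrightarrow> cmod (dom_action t \<delta> g) \<le> B g"
      by metis
    define M where "M = Max (insert 0 (B ` I))"
    have M: "0 \<le> M" "\<And>g. g \<in> I \<Longrightarrow> B g \<le> M"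
      using I(1) by (auto simp: M_def)
    define r where "r = (M + 1) / \<epsilon>"
    have r: "r > 0" "M < r * \<epsilon>"
      using M(1) I(2) by (auto simp: r_def)
    have "dom_action t \<delta> \<in> (\<lambda>u. r \<odot>\<^bsub>complex_functions\<^esub> u) ` U" if t: "t \<in> carrier G" for t
    proof (rule image_eqI)
      show "dom_action t \<delta> = r \<odot>\<^bsub>complex_functions\<^esub> (\<lambda>g. dom_action t \<delta> g / complex_of_real r)"
        using r(1) by simp
      have "cmod (dom_action t \<delta> g / complex_of_real r) < \<epsilon>" if "g \<in> I" for g
      proof -
        have "cmod (dom_action t \<delta> g) < r * \<epsilon>"
          using B[OF t, of g] M(2)[OF that] r(2) by linarith
        then show ?thesis
          using r(1) by (simp add: norm_divide divide_less_eq mult.commute)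
      qed
      then show "(\<lambda>g. dom_action t \<delta> g / complex_of_real r) \<in> U"
        by (intro subsetD[OF I(3)]) simp
    qed
    then show "\<exists>r>0. orbit G dom_action \<delta> \<subseteq> (\<lambda>u. r \<odot>\<^bsub>complex_functions\<^esub> u) ` U"
      using r(1) unfolding orbit_def by blast
  qed
  ultimately show ?thesis
    unfolding locally_bounded_action_def by blast
qed

theorem fixed_point_property_imp_normalized_integral:
  assumes "f \<noteq> (\<lambda>_. 0)" "fixed_point_property_cones G TYPE(('a \<Rightarrow> complex) \<Rightarrow> complex)"
  shows "\<exists>\<mu>. normalized_integral G f \<mu>"
proof -
  have "\<exists>\<mu>\<in>dom_cone. \<mu> \<noteq> \<zero>\<^bsub>complex_functions\<^esub> \<and> (\<forall>t\<in>carrier G. dom_action t \<mu> = \<mu>)"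
    by (rule assms(2)[unfolded fixed_point_property_cones_def, THEN spec, THEN spec, THEN spec, THEN spec,
          THEN mp, of _ euclidean])
      (intro conjI ballI hausdorff_lctvs_complex_functions continuous_linear_dom_action cone_in_dom_cone
        dom_action_cone proper_dom_cone weakly_complete_dom_cone cobounded_dom_cone
        locally_bounded_dom_cone[OF assms(1)])
  then obtain \<mu> where \<mu>: "\<mu> \<in> dom_cone" "\<mu> \<noteq> (\<lambda>_. 0)" and fixed: "\<And>t. t \<in> carrier G \<Longrightarrow> dom_action t \<mu> = \<mu>"
    unfolding complex_functions_simps by blast
  note pos = dom_coneD(2)[OF \<mu>(1)]
  have inv: "\<mu> (translate G t g) = \<mu> g" if "t \<in> carrier G" "g \<in> linf_dom G f" for t g
    using fun_cong[OF fixed[of "inv t"], of g] that by (simp add: dom_action_def)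
  have "\<mu> f \<noteq> 0"
  proof
    assume "\<mu> f = 0"
    have "\<mu> g = 0" for g
    proof (cases "g \<in> linf_dom G f")
      case True
      then obtain n and t :: "nat \<Rightarrow> 'a" where t: "\<And>j. j \<in> {1..n} \<Longrightarrow> t j \<in> carrier G"
        and le: "\<And>s. s \<in> carrier G \<Longrightarrow> complex_of_real (cmod (g s)) \<le> (\<Sum>j=1..n. translate G (t j) f s)"
        unfolding linf_dom_def by blast
      note sum = positive_functional_sum[OF solid_linf_dom pos, of "{1..n}"
          "\<lambda>j. translate G (t j) f", OF finite_atLeastAtMost translate_f_linf_dom[OF t]]
      have "\<mu> (\<lambda>s. \<Sum>j=1..n. translate G (t j) f s) = 0"
        using sum inv[OF t f_linf_dom] \<open>\<mu> f = 0\<close> by simp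
      then show ?thesis
        by (rule positive_functional_null[OF solid_linf_dom pos _ _ le, rotated 3])
          (use True linf_dom_subset sum in auto)
    next
      case False
      then show ?thesis by (rule dom_coneD(1)[OF \<mu>(1)])
    qed
    then show False using \<mu>(2) by auto
  qed
  moreover have "0 \<le> \<mu> f"
    by (rule positive_functionalD(3)[OF pos f_linf_dom f_nonneg])
  moreover define r where "r = Re (\<mu> f)"
  ultimately have r: "\<mu> f = complex_of_real r" "r > 0"
    by (auto simp: less_eq_complex_def complex_eq_iff)
  have nonneg: "0 \<le> z / complex_of_real r" if "0 \<le> z" for z
    using r(2) that by (simp add: less_eq_complex_def Re_divide_of_real Im_divide_of_real)
  have "normalized_integral G f (\<lambda>g. \<mu> g / \<mu> f)"
    unfolding normalized_integral_def invariant_integral_iff positive_functional_def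
    using positive_functionalD[OF pos] inv r nonneg by (simp add: add_divide_distrib)
  then show ?thesis by blast
qed

end

theorem proposition4p3:
  fixes G :: "('g, 'b) monoid_scheme"
  assumes "group G" and "countable (carrier G)" and "infinite (carrier G)"
  shows "\<exists>f\<in>linf G. f \<noteq> (\<lambda>_. 0) \<and> (\<forall>s. 0 \<le> f s) \<and>
    (\<forall>\<mu>. invariant_integral G (linf_c G f) \<mu> \<longrightarrow> (\<forall>g\<in>linf_c G f. \<mu> g = 0)) \<and>
    (\<forall>\<mu>. normalized_integral G f \<mu> \<longrightarrow> singular_integral G f \<mu>) \<and>
    (fixed_point_property_cones G TYPE(('g \<Rightarrow> complex) \<Rightarrow> complex) \<longrightarrow>
       (\<exists>\<mu>. normalized_integral G f \<mu>))"
proof -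
  obtain f where "positive_linf G f" and nz: "f \<noteq> (\<lambda>_. 0)"
    and null: "\<forall>\<mu>. invariant_integral G (linf_c G f) \<mu> \<longrightarrow> (\<forall>g\<in>linf_c G f. \<mu> g = 0)"
    using group.ex_positive_linf_no_integral[OF assms(1,3)] by blast
  then interpret positive_linf G f by simp
  have "singular_integral G f \<mu>" if "normalized_integral G f \<mu>" for \<mu>
  proof -
    have "invariant_integral G (linf_dom G f) \<mu>"
      using that by (simp add: normalized_integral_def)
    then have "invariant_integral G (linf_c G f) \<mu>"
      by (rule invariant_integral_subset) (simp add: linf_c_eq_linf_cpt linf_cpt_subset_linf_dom)
    then show ?thesis using null unfolding singular_integral_def by blast
  qed
  then show ?thesis
    using f_nonneg nz null fixed_point_property_imp_normalized_integral[OF nz]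
    by (intro bexI[OF _ f_linf] conjI allI impI) blast+
qed

end
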